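(* Let $S=\{a_1,a_2,\dots,a_n\}$ be a finite set of $n$ non-zero integers, let $d\ge 3$ be an integer with $8\mid d$, let $\zeta_d$ be a primitive $d$-th root of unity, and let $\mathbb{K}=\mathbb{Q}(\sqrt{a_1},\sqrt{a_2},\dots,\sqrt{a_n},\zeta_d)$. Then $$[\mathbb{K}:\mathbb{Q}]=\frac{2^n\varphi(d)}{|\overline{\mathcal{D}_0}|\,|\mathcal{H}(S)|}.$$
   Context: For a non-zero integer $n$, $\mathrm{sqf}(n)$ is its squarefree part: the unique squarefree integer $s$ (of the same sign as $n$) with $n=sm^2$ for some integer $m$. For a finite set $T$ of non-zero integers, $\mathrm{sqf}(T)=\mathrm{sqf}\left(\prod_{s\in T}s\right)$, and $\mathrm{sqf}(\emptyset)=1$. $\mathbf{P}(S)$ is the group of all subsets of $S$ under symmetric difference $\triangle$. $\mathcal{H}(S)=\{T\subseteq S:\prod_{s\in T}s=m^2\text{ for some } m\in\mathbb{Z}\}$ (the empty product being $1$), a subgroup of $\mathbf{P}(S)$. $\overline{\mathbf{P}(S)}=\mathbf{P}(S)/\mathcal{H}(S)$, and $\mathrm{sqf}(\overline{T})=\mathrm{sqf}(T)$ is well defined on cosets $\overline{T}$. $\overline{\mathcal{D}_0}=\{\overline{T}\in\overline{\mathbf{P}(S)}:|\mathrm{sqf}(\overline{T})|\text{ divides } d\}$. $\varphi$ is Euler's function. *)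

theory Defs
  imports
    "HOL-Algebra.Algebraic_Closure_Type"
    "HOL-Algebra.Generated_Fields"
    "HOL-Number_Theory.Totient"
begin

subsection \<open>Squarefree parts\<close>

abbreviation sqf :: "int \<Rightarrow> int" where
  "sqf \<equiv> squarefree_part"

text \<open>
  For non-zero integers the library function is the signed squarefree part: the
  unique squarefree \<open>s\<close> of the same sign as \<open>n\<close> with \<open>n = s m\<^sup>2\<close>.
\<close>

lemma sgn_mult_square:
  fixes a m :: int
  assumes "m \<noteq> 0"
  shows "sgn (a * m ^ 2) = sgn a"
proof -
  have "sgn (m ^ 2) = 1" using assms by (intro sgn_pos) simp
  thus ?thesis by (simp only: sgn_mult mult_1_right)
qed

lemma sqf_unique:
  fixes n s :: int
  assumes n: "n \<noteq> 0"
  shows "sqf n = s \<longleftrightarrow> squarefree s \<and> sgn s = sgn n \<and> (\<exists>m. n = s * m ^ 2)"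
proof
  assume s: "sqf n = s"
  have dec: "n = s * square_part n ^ 2"
    unfolding s[symmetric] by (rule squarefree_decompose)
  moreover have "sgn (s * square_part n ^ 2) = sgn s"
    using n by (intro sgn_mult_square) simp
  ultimately have "sgn s = sgn n" by (rule arg_cong[where f = sgn, THEN trans, symmetric])
  thus "squarefree s \<and> sgn s = sgn n \<and> (\<exists>m. n = s * m ^ 2)"
    using dec s by blast
next
  assume "squarefree s \<and> sgn s = sgn n \<and> (\<exists>m. n = s * m ^ 2)"
  then obtain m where s: "squarefree s" "sgn s = sgn n" and m: "n = s * m ^ 2" by blast
  from n m have nz: "s \<noteq> 0" "m \<noteq> 0" by auto
  have mult: "multiplicity p (sqf n) = multiplicity p s" if p: "prime p" for p
  proof -
    have "multiplicity p n = multiplicity p s + 2 * multiplicity p m"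
      using prime_imp_prime_elem[OF p] nz unfolding m
      by (simp add: prime_elem_multiplicity_mult_distrib prime_elem_multiplicity_power_distrib)
    moreover have "multiplicity p s \<le> 1"
      using s(1) nz p squarefree_factorial_semiring'' by blast
    ultimately show ?thesis
      using prime_multiplicity_squarefree_part[OF p, of n] by simp
  qed
  hence "normalize (sqf n) = normalize s"
    using nz by (intro multiplicity_eq_imp_eq) auto
  hence abs: "\<bar>sqf n\<bar> = \<bar>s\<bar>" by simp
  have "n = sqf n * square_part n ^ 2" by (rule squarefree_decompose)
  moreover have "sgn (sqf n * square_part n ^ 2) = sgn (sqf n)"
    using n by (intro sgn_mult_square) simp
  ultimately have "sgn n = sgn (sqf n)" by (rule arg_cong[where f = sgn, THEN trans])
  hence "sgn (sqf n) = sgn s" using s(2) by simp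
  with abs show "sqf n = s" by (metis mult_sgn_abs)
qed

definition sqf_set :: "int set \<Rightarrow> int" where
  "sqf_set T = sqf (\<Prod>T)"


subsection \<open>The group of subsets of \<open>S\<close> and its quotient\<close>

definition subset_group :: "'a set \<Rightarrow> 'a set monoid" where
  "subset_group S = \<lparr>carrier = Pow S, monoid.mult = sym_diff, one = {}\<rparr>"

definition square_subsets :: "int set \<Rightarrow> int set set" where
  "square_subsets S = {T \<in> Pow S. \<exists>m. \<Prod>T = m ^ 2}"

definition subset_quotient :: "int set \<Rightarrow> int set set monoid" where
  "subset_quotient S = subset_group S Mod square_subsets S"

text \<open>
  The common value of \<^const>\<open>sqf_set\<close> on a coset; see \<open>sqf_coset_r_coset\<close> below
  for well-definedness.
\<close>

definition sqf_coset :: "int set set \<Rightarrow> int" where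
  "sqf_coset C = the_elem (sqf_set ` C)"

definition D0_bar :: "int set \<Rightarrow> nat \<Rightarrow> int set set set" where
  "D0_bar S d = {C \<in> carrier (subset_quotient S). \<bar>sqf_coset C\<bar> dvd int d}"

lemma comm_group_subset_group: "comm_group (subset_group S)"
proof (rule comm_groupI)
  fix x assume "x \<in> carrier (subset_group S)"
  thus "\<exists>y\<in>carrier (subset_group S). y \<otimes>\<^bsub>subset_group S\<^esub> x = \<one>\<^bsub>subset_group S\<^esub>"
    by (intro bexI[of _ x]) (auto simp: subset_group_def)
qed (auto simp: subset_group_def)

lemma prod_sym_diff:
  fixes A B :: "int set"
  assumes "finite A" "finite B"
  shows "\<Prod>(sym_diff A B) * (\<Prod>(A \<inter> B)) ^ 2 = \<Prod>A * \<Prod>B"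
proof -
  have "\<Prod>(sym_diff A B) = \<Prod>(A - B) * \<Prod>(B - A)"
    using assms by (intro prod.union_disjoint) auto
  moreover have "\<Prod>A = \<Prod>(A - B) * \<Prod>(A \<inter> B)"
    using assms prod.Int_Diff[of A "\<lambda>x. x" B] by (simp add: mult.commute)
  moreover have "\<Prod>B = \<Prod>(B - A) * \<Prod>(A \<inter> B)"
    using assms prod.Int_Diff[of B "\<lambda>x. x" A] by (simp add: mult.commute Int_commute)
  ultimately show ?thesis by (simp add: power2_eq_square algebra_simps)
qed

lemma prod_set_nonzero:
  fixes T :: "int set"
  assumes "finite S" "0 \<notin> S" "T \<subseteq> S"
  shows "\<Prod>T \<noteq> 0"
  using assms finite_subset[of T S] by auto

lemma sqf_mult_square:
  fixes a b m :: int
  assumes "a \<noteq> 0" "m \<noteq> 0" "a * k ^ 2 = b * m ^ 2" "b \<noteq> 0"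
  shows "sqf a = sqf b"
proof -
  have k: "k \<noteq> 0" using assms by auto
  have *: "sqf (c * j ^ 2) = sqf c" if c: "c \<noteq> 0" "j \<noteq> 0" for c j :: int
  proof -
    have "c * j ^ 2 = (sqf c * square_part c ^ 2) * j ^ 2"
      by (rule arg_cong[where f = "\<lambda>x. x * j ^ 2", OF squarefree_decompose])
    hence "c * j ^ 2 = sqf c * (square_part c * j) ^ 2"
      by (simp only: power_mult_distrib mult.assoc)
    hence "\<exists>m. c * j ^ 2 = sqf c * m ^ 2" by blast
    moreover have "sgn (sqf c) = sgn c"
      using sqf_unique[of c "sqf c"] c by blast
    hence "sgn (sqf c) = sgn (c * j ^ 2)" using c by (simp add: sgn_mult_square)
    moreover have "c * j ^ 2 \<noteq> 0" using c by simp
    ultimately show ?thesis using sqf_unique by blast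
  qed
  have "sqf a = sqf (a * k ^ 2)" using * k assms(1) by simp
  also have "\<dots> = sqf b" using * assms by simp
  finally show ?thesis .
qed

lemma subgroup_square_subsets:
  assumes S: "finite S" "0 \<notin> S"
  shows "subgroup (square_subsets S) (subset_group S)"
proof -
  interpret comm_group "subset_group S" by (rule comm_group_subset_group)
  show ?thesis
  proof (rule subgroupI)
    show "square_subsets S \<subseteq> carrier (subset_group S)"
      by (auto simp: square_subsets_def subset_group_def)
    show "square_subsets S \<noteq> {}"
      by (auto simp: square_subsets_def intro!: exI[of _ "{}"] exI[of _ 1])
  next
    fix A assume A: "A \<in> square_subsets S"
    hence "inv\<^bsub>subset_group S\<^esub> A = A"
      by (intro inv_equality) (auto simp: subset_group_def square_subsets_def)
    thus "inv\<^bsub>subset_group S\<^esub> A \<in> square_subsets S" using A by simp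
  next
    fix A B assume AB: "A \<in> square_subsets S" "B \<in> square_subsets S"
    hence sub: "A \<subseteq> S" "B \<subseteq> S" by (auto simp: square_subsets_def)
    hence fin: "finite A" "finite B" using S finite_subset by auto
    from AB obtain a b where ab: "\<Prod>A = a ^ 2" "\<Prod>B = b ^ 2"
      by (auto simp: square_subsets_def)
    have eq: "\<Prod>(sym_diff A B) * (\<Prod>(A \<inter> B)) ^ 2 = (a * b) ^ 2"
      using prod_sym_diff[OF fin] ab by (simp add: power_mult_distrib)
    have nz: "\<Prod>(A \<inter> B) \<noteq> 0" using prod_set_nonzero[OF S] sub by blast
    have "(\<Prod>(A \<inter> B)) ^ 2 dvd (a * b) ^ 2" using eq by (metis dvd_triv_right)
    hence "\<Prod>(A \<inter> B) dvd a * b" by simp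
    then obtain c where c: "a * b = \<Prod>(A \<inter> B) * c" by blast
    have "\<Prod>(sym_diff A B) * (\<Prod>(A \<inter> B)) ^ 2 = c ^ 2 * (\<Prod>(A \<inter> B)) ^ 2"
      using eq c by (simp add: power_mult_distrib mult_ac)
    hence "\<Prod>(sym_diff A B) = c ^ 2" using nz by simp
    thus "A \<otimes>\<^bsub>subset_group S\<^esub> B \<in> square_subsets S"
      using sub by (auto simp: square_subsets_def subset_group_def)
  qed
qed

lemma group_subset_quotient:
  assumes "finite S" "0 \<notin> S"
  shows "group (subset_quotient S)"
  unfolding subset_quotient_def
  using comm_group.subgroup_imp_normal[OF comm_group_subset_group subgroup_square_subsets[OF assms]]
  by (rule normal.factorgroup_is_group)

lemma sqf_coset_r_coset:
  assumes S: "finite S" "0 \<notin> S" and T: "T \<subseteq> S"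
  shows "sqf_coset (square_subsets S #>\<^bsub>subset_group S\<^esub> T) = sqf_set T"
proof -
  have "sqf_set (sym_diff A T) = sqf_set T" if A: "A \<in> square_subsets S" for A
  proof -
    from A obtain a where a: "\<Prod>A = a ^ 2" and AS: "A \<subseteq> S"
      by (auto simp: square_subsets_def)
    have fin: "finite A" "finite T" using S AS T finite_subset by auto
    have "\<Prod>(sym_diff A T) * (\<Prod>(A \<inter> T)) ^ 2 = \<Prod>T * a ^ 2"
      using prod_sym_diff[OF fin] a by (simp add: mult.commute)
    moreover have "\<Prod>(sym_diff A T) \<noteq> 0"
      by (rule prod_set_nonzero[OF S]) (use AS T in auto)
    moreover have "\<Prod>T \<noteq> 0" by (rule prod_set_nonzero[OF S T])
    moreover have "a \<noteq> 0" using prod_set_nonzero[OF S AS] a by auto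
    ultimately show ?thesis
      unfolding sqf_set_def by (intro sqf_mult_square)
  qed
  hence "sqf_set ` (square_subsets S #>\<^bsub>subset_group S\<^esub> T) \<subseteq> {sqf_set T}"
    by (auto simp: r_coset_def subset_group_def)
  moreover have "{} \<in> square_subsets S"
    by (auto simp: square_subsets_def intro!: exI[of _ 1])
  hence "(square_subsets S #>\<^bsub>subset_group S\<^esub> T) \<noteq> {}"
    by (auto simp: r_coset_def)
  ultimately have "sqf_set ` (square_subsets S #>\<^bsub>subset_group S\<^esub> T) = {sqf_set T}"
    by (metis image_is_empty subset_singletonD)
  thus ?thesis by (simp add: sqf_coset_def)
qed


subsection \<open>The field and its degree\<close>

definition primitive_root_of_unity :: "nat \<Rightarrow> complex \<Rightarrow> bool" where
  "primitive_root_of_unity d z \<longleftrightarrow> d > 0 \<and> z ^ d = 1 \<and> (\<forall>k. 0 < k \<and> k < d \<longrightarrow> z ^ k \<noteq> 1)"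

abbreviation complex_ring :: "complex ring" where
  "complex_ring \<equiv> ring_of_type_algebra"

definition adjoin_Q :: "complex set \<Rightarrow> complex set" where
  "adjoin_Q A = generate_field complex_ring (\<rat> \<union> A)"

text \<open>
  \<^const>\<open>ring.dim\<close> is a definite description and is only meaningful together with
  \<^const>\<open>ring.finite_dimension\<close>.
\<close>

abbreviation finite_over_Q :: "complex set \<Rightarrow> bool" where
  "finite_over_Q K \<equiv> ring.finite_dimension complex_ring \<rat> K"

abbreviation degree_over_Q :: "complex set \<Rightarrow> nat" where
  "degree_over_Q K \<equiv> ring.dim complex_ring \<rat> K"

lemma field_complex_ring: "field complex_ring"
  by (rule field_from_type_algebra)

lemma subfield_adjoin_Q: "subfield (adjoin_Q A) complex_ring"
  unfolding adjoin_Q_def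
  by (rule field.generate_field_is_subfield[OF field_complex_ring])
     (simp add: ring_of_type_algebra_def)

end

theory Submission
  imports Defs "HOL-Number_Theory.Residues"
begin

text \<open>
  Let \<open>F = \<rat>(\<zeta>\<^sub>d)\<close>, of degree \<open>\<phi>(d)\<close> over \<open>\<rat>\<close>. Adjoining the square roots of the elements
  of \<open>S\<close> one at a time gives \<open>[F(\<surd>S) : F] \<cdot> N = 2\<^sup>n\<close>, where \<open>N\<close> is the number of \<open>T \<subseteq> S\<close> whose
  product has a square root in \<open>F\<close>. As \<open>8\<close> divides \<open>d\<close>, an integer \<open>m\<close> has a square root in \<open>F\<close>
  iff \<open>sqf m\<close> divides \<open>d\<close>: a prime dividing \<open>sqf m\<close> but not \<open>d\<close> would ramify, whereas
  \<open>\<int>[\<zeta>\<^sub>d]/p\<close> is reduced for \<open>p\<close> not dividing \<open>d\<close>; conversely \<open>-1\<close> and \<open>2\<close> have square roots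
  in \<open>\<rat>(\<zeta>\<^sub>8)\<close>, and up to sign so does every odd \<open>t\<close> in \<open>\<rat>(\<zeta>\<^sub>t)\<close>. The sets counted by \<open>N\<close> are
  the union of the cosets of \<open>\<H>(S)\<close> that make up the quotient set \<open>D\<^sub>0\<close>.
\<close>

section \<open>Integer polynomials at roots of unity\<close>

text \<open>The values \<open>ev z g\<close> make up the ring Z[z]. With integer coefficients,
  divisibility by a prime in this ring can be written as \<open>of_nat p * ev z h\<close>.\<close>

definition ev :: "complex \<Rightarrow> int poly \<Rightarrow> complex" where
  "ev z g = poly (map_poly of_int g) z"

lemma ev_0 [simp]: "ev z 0 = 0"
  by (simp add: ev_def)

lemma ev_pCons [simp]: "ev z (pCons a g) = of_int a + z * ev z g"
  by (simp add: ev_def map_poly_pCons)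

lemma ev_1 [simp]: "ev z 1 = 1"
  by (simp add: one_pCons)

lemma ev_add [simp]: "ev z (g + h) = ev z g + ev z h"
  by (induction g h rule: poly_induct2) (auto simp: algebra_simps)

lemma ev_smult [simp]: "ev z (smult a g) = of_int a * ev z g"
  by (induction g) (auto simp: algebra_simps)

lemma ev_minus [simp]: "ev z (- g) = - ev z g"
  by (induction g) auto

lemma ev_diff [simp]: "ev z (g - h) = ev z g - ev z h"
  using ev_add[of z g "- h"] by simp

lemma ev_mult [simp]: "ev z (g * h) = ev z g * ev z h"
  by (induction g) (auto simp: algebra_simps)

lemma ev_power [simp]: "ev z (g ^ k) = ev z g ^ k"
  by (induction k) auto

lemma ev_monom [simp]: "ev z (Polynomial.monom a k) = of_int a * z ^ k"
  by (induction k) (auto simp: monom_0 monom_Suc)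

lemma ev_pcompose [simp]: "ev z (g \<circ>\<^sub>p h) = ev (ev z h) g"
  by (induction g) (auto simp: pcompose_pCons)

section \<open>Frobenius congruences modulo a prime\<close>

text \<open>The inner binomial coefficients are multiples of \<open>p\<close>. The general ring
  covers both integers and integer polynomials.\<close>

lemma prime_dvd_sum_power_diff:
  fixes u v :: "'a :: comm_ring_1"
  assumes p: "prime p"
  shows "of_nat p dvd (u + v) ^ p - (u ^ p + v ^ p)"
proof -
  have p1: "p > 1" using p by (rule prime_gt_1_nat)
  let ?t = "\<lambda>k. of_nat (p choose k) * u ^ k * v ^ (p - k)"
  have "(u + v) ^ p = (\<Sum>k\<le>p. ?t k)" by (simp add: binomial_ring)
  also have "{..p} = insert 0 (insert p {1..<p})" using p1 by auto
  also have "(\<Sum>k\<in>\<dots>. ?t k) = v ^ p + (u ^ p + (\<Sum>k\<in>{1..<p}. ?t k))"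
    using p1 by (subst sum.insert; simp)+
  finally have "(u + v) ^ p - (u ^ p + v ^ p) = (\<Sum>k\<in>{1..<p}. ?t k)" by simp
  moreover have "of_nat p dvd ?t k" if "k \<in> {1..<p}" for k
  proof -
    have "p dvd p choose k" using that p by (intro dvd_choose_prime) auto
    hence "(of_nat p :: 'a) dvd of_nat (p choose k)" by (auto elim!: dvdE)
    thus ?thesis by (simp add: mult.assoc)
  qed
  hence "of_nat p dvd (\<Sum>k\<in>{1..<p}. ?t k)" by (intro dvd_sum) auto
  ultimately show ?thesis by simp
qed

text \<open>Fermat's little theorem: the binomial congruence gives an induction over the naturals,
  and reduction modulo \<open>p\<close> brings every integer into that range.\<close>

lemma prime_dvd_power_diff_int:
  assumes p: "prime p"
  shows "int p dvd a ^ p - a"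
proof -
  have "int p dvd int n ^ p - int n" for n
  proof (induction n)
    case 0
    then show ?case using prime_gt_0_nat[OF p] by (simp add: zero_power)
  next
    case (Suc n)
    have "int p dvd (int n + 1) ^ p - (int n ^ p + 1 ^ p)"
      using prime_dvd_sum_power_diff[OF p, of "int n" 1] by simp
    hence "int p dvd ((int n + 1) ^ p - (int n ^ p + 1 ^ p)) + (int n ^ p - int n)"
      using Suc.IH by (rule dvd_add)
    then show ?case by (simp add: algebra_simps)
  qed
  note nonneg = this
  have "[a = int (nat (a mod int p))] (mod int p)"
    using prime_gt_0_nat[OF p] by (simp add: cong_def)
  hence "[a ^ p - a = int (nat (a mod int p)) ^ p - int (nat (a mod int p))] (mod int p)"
    by (intro cong_diff cong_pow)
  thus ?thesis using nonneg cong_dvd_iff cong_sym by blast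
qed

text \<open>Modulo \<open>p\<close> the \<open>p\<close>-th power is additive and, by Fermat, fixes
  the coefficients, so it only replaces X by X^p.\<close>

lemma frobenius_int_poly:
  fixes g :: "int poly"
  assumes p: "prime p"
  shows "of_nat p dvd g ^ p - g \<circ>\<^sub>p Polynomial.monom 1 p"
proof (induction g)
  case 0
  then show ?case using prime_gt_0_nat[OF p] by (simp add: zero_power)
next
  case (pCons a g)
  let ?X = "[:0, 1:] :: int poly"
  let ?G = "g \<circ>\<^sub>p Polynomial.monom 1 p"
  have X: "Polynomial.monom 1 p = ?X ^ p" by (simp add: monom_altdef)
  have "of_nat p dvd ([:a:] + ?X * g) ^ p - ([:a:] ^ p + (?X * g) ^ p)"
    using p by (rule prime_dvd_sum_power_diff)
  moreover have "of_nat p dvd [:a:] ^ p - [:a:]"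
  proof -
    obtain c where "a ^ p - a = int p * c" using prime_dvd_power_diff_int[OF p] by (auto elim!: dvdE)
    hence "[:a:] ^ p - [:a:] = of_nat p * [:c:]" by (simp add: poly_const_pow of_nat_poly)
    thus ?thesis by (metis dvd_triv_left)
  qed
  moreover have "of_nat p dvd ?X ^ p * (g ^ p - ?G)"
    using pCons.IH by (rule dvd_mult)
  ultimately have "of_nat p dvd (([:a:] + ?X * g) ^ p - ([:a:] ^ p + (?X * g) ^ p)) +
      (([:a:] ^ p - [:a:]) + ?X ^ p * (g ^ p - ?G))"
    by (intro dvd_add)
  also have "\<dots> = ([:a:] + ?X * g) ^ p - ([:a:] + ?X ^ p * ?G)"
    by (simp only: power_mult_distrib right_diff_distrib)
  also have "[:a:] + ?X * g = pCons a g" by simp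
  also have "[:a:] + ?X ^ p * ?G = pCons a g \<circ>\<^sub>p Polynomial.monom 1 p"
    by (simp only: pcompose_pCons X)
  finally show ?case .
qed

lemma ev_of_nat [simp]: "ev z (of_nat n) = of_nat n"
  by (simp add: of_nat_poly)

lemma ev_frobenius:
  assumes "prime p"
  obtains h where "ev z g ^ p = ev (z ^ p) g + of_nat p * ev z h"
proof -
  obtain h where "g ^ p - g \<circ>\<^sub>p Polynomial.monom 1 p = of_nat p * h"
    using frobenius_int_poly[OF assms] by (auto elim!: dvdE)
  hence "ev z (g ^ p - g \<circ>\<^sub>p Polynomial.monom 1 p) = ev z (of_nat p * h)" by simp
  hence "ev z g ^ p = ev (z ^ p) g + of_nat p * ev z h" by (simp add: algebra_simps)
  thus ?thesis using that by blast
qed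

section \<open>Monic division and minimal polynomials over the integers\<close>

lemma ev_eq_mod_monic:
  assumes f: "Polynomial.lead_coeff f = 1" "Polynomial.degree f > 0" and z: "ev z f = 0"
  obtains r where "ev z r = ev z g" "Polynomial.degree r < Polynomial.degree f"
proof -
  obtain q r where qr: "pseudo_divmod g f = (q, r)" by force
  have "f \<noteq> 0" using f by auto
  note pd = pseudo_divmod[OF this qr]
  have "g = f * q + r" using pd(1) f by simp
  hence "ev z g = ev z r" using z by simp
  with pd(2) f that[of r] show ?thesis by auto
qed

text \<open>The last conjunct makes \<open>f\<close> a generator of the kernel of evaluation on
  Z[X]. As \<open>f\<close> is monic, it is the usual minimal polynomial of an algebraic integer,
  with divisibility taken over the integers.\<close>

definition minimal_int_poly :: "complex \<Rightarrow> int poly \<Rightarrow> bool" where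
  "minimal_int_poly z f \<longleftrightarrow>
    Polynomial.lead_coeff f = 1 \<and> Polynomial.degree f > 0 \<and> (\<forall>g. ev z g = 0 \<longleftrightarrow> f dvd g)"

lemma minimal_int_polyD:
  assumes "minimal_int_poly z f"
  shows "Polynomial.lead_coeff f = 1" "ev z f = 0" "\<And>g. ev z g = 0 \<longleftrightarrow> f dvd g"
    "Polynomial.degree f > 0"
  using assms unfolding minimal_int_poly_def by auto

text \<open>A primitive polynomial of least degree vanishing at \<open>z\<close> divides every other
  one over the rationals, and by Gauss's lemma over the integers. Since it divides the monic
  \<open>F\<close>, it is monic up to sign.\<close>

lemma minimal_int_poly_exists:
  assumes z: "ev z F = 0" and F: "Polynomial.lead_coeff F = 1"
  shows "\<exists>f. minimal_int_poly z f"
proof -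
  let ?P = "\<lambda>g. g \<noteq> 0 \<and> ev z g = 0"
  have "?P F" using z F by auto
  then obtain f0 where f0: "?P f0" and
    min: "\<And>g. ?P g \<Longrightarrow> Polynomial.degree f0 \<le> Polynomial.degree g"
    using ex_has_least_nat[of ?P F Polynomial.degree] by blast
  define f1 where "f1 = primitive_part f0"
  have f1: "content f1 = 1" "f1 \<noteq> 0" using f0 by (auto simp: f1_def)
  have "of_int (content f0) * ev z f1 = ev z (smult (content f0) f1)" by simp
  also have "\<dots> = 0" using f0 unfolding f1_def by (simp del: ev_smult)
  finally have zf1: "ev z f1 = 0" using f0 by simp
  have dvd: "f1 dvd g" if g: "ev z g = 0" for g
  proof -
    let ?r = "pseudo_mod g f1"
    obtain a q where aq: "a \<noteq> 0" "smult a g = f1 * q + ?r"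
      using pseudo_mod(1)[OF f1(2)] by blast
    have "ev z ?r = ev z (smult a g - f1 * q)" using aq by simp
    also have "\<dots> = 0" using g zf1 by simp
    finally have r: "ev z ?r = 0" .
    have "Polynomial.degree f1 \<le> Polynomial.degree ?r" if "?r \<noteq> 0"
      using min[of ?r] r that by (simp add: f1_def)
    hence "?r = 0" using pseudo_mod(2)[OF f1(2), of g] by linarith
    hence eq: "smult a g = f1 * q" using aq by simp
    \<comment> \<open>Content is multiplicative and \<open>f1\<close> is primitive, so the
      multiplier \<open>a\<close> of the pseudo-division can be cancelled from
      \<open>q\<close>.\<close>
    hence "content (smult a g) = content q" using f1 by (simp add: content_mult)
    hence "a dvd content q" by (metis content_smult dvd_triv_left normalize_dvd_iff dvd_trans)
    then obtain b where b: "content q = a * b" by (auto elim!: dvdE)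
    have "q = smult a (smult b (primitive_part q))"
      using content_times_primitive_part[of q] b by simp
    hence "smult a (g - f1 * smult b (primitive_part q)) = 0"
      using eq by (simp add: smult_diff_right) (metis mult_smult_right smult_smult)
    hence "g = f1 * smult b (primitive_part q)" using aq(1) by simp
    thus ?thesis by (metis dvd_triv_left)
  qed
  obtain h where h: "F = f1 * h" using dvd[OF z] by (auto elim!: dvdE)
  hence lc: "Polynomial.lead_coeff f1 * Polynomial.lead_coeff h = 1"
    using F by (simp add: lead_coeff_mult)
  define f where "f = smult (Polynomial.lead_coeff h) f1"
  have "h \<noteq> 0" using lc by auto
  with lc have lf: "Polynomial.lead_coeff f = 1" by (simp add: f_def mult.commute)
  moreover have zf: "ev z f = 0" using zf1 by (simp add: f_def)
  moreover have "ev z g = 0 \<longleftrightarrow> f dvd g" for g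
  proof
    assume "ev z g = 0"
    then obtain k where k: "g = f1 * k" using dvd by (auto elim!: dvdE)
    have "g = f * smult (Polynomial.lead_coeff f1) k"
      using lc k by (simp add: f_def)
    thus "f dvd g" by (metis dvd_triv_left)
  qed (use zf in \<open>auto elim!: dvdE\<close>)
  moreover have "Polynomial.degree f > 0"
  proof (rule ccontr)
    assume "\<not> ?thesis"
    then obtain c where "f = [:c:]" using degree_eq_zeroE by blast
    thus False using lf zf by simp
  qed
  ultimately show ?thesis unfolding minimal_int_poly_def by blast
qed

lemma lead_coeff_monom_minus_1:
  assumes "d > 0"
  shows "Polynomial.lead_coeff (Polynomial.monom 1 d - 1 :: int poly) = 1"
    "Polynomial.degree (Polynomial.monom 1 d - 1 :: int poly) = d"
proof -
  have "Polynomial.degree (Polynomial.monom 1 d + (- 1) :: int poly) = Polynomial.degree (Polynomial.monom (1::int) d)"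
    using assms by (intro degree_add_eq_left) (simp add: degree_monom_eq)
  thus deg: "Polynomial.degree (Polynomial.monom 1 d - 1 :: int poly) = d"
    by (simp add: degree_monom_eq)
  show "Polynomial.lead_coeff (Polynomial.monom 1 d - 1 :: int poly) = 1"
    unfolding deg using assms by simp
qed

lemma root_of_unity_minimal_poly:
  assumes "z ^ d = 1" "d > 0"
  obtains f where "minimal_int_poly z f"
proof -
  have "ev z (Polynomial.monom 1 d - 1) = 0" using assms by simp
  thus ?thesis
    using lead_coeff_monom_minus_1(1)[OF assms(2)] minimal_int_poly_exists that by blast
qed

text \<open>Modulo the minimal polynomial, \<open>g\<close> may be taken of smaller degree than it.
  A polynomial of such degree vanishing at \<open>z\<close> is zero, so comparing constant
  coefficients brings divisibility from Z[z] down to Z.\<close>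

lemma dvd_if_eq_mult_ev:
  assumes z: "z ^ d = 1" "d > 0" and eq: "of_int k = of_int m * ev z g"
  shows "m dvd k"
proof -
  obtain f where "minimal_int_poly z f"
    using z by (rule root_of_unity_minimal_poly)
  note f = minimal_int_polyD[OF this]
  obtain r where r: "ev z r = ev z g" "Polynomial.degree r < Polynomial.degree f"
    using f(1,4,2) by (rule ev_eq_mod_monic)
  let ?u = "[:k:] - smult m r"
  have "ev z ?u = 0" using eq r by simp
  hence "f dvd ?u" using f by blast
  moreover have "Polynomial.degree ?u < Polynomial.degree f"
    using r f(4) by (intro degree_diff_less) (auto intro: le_less_trans[OF degree_smult_le])
  ultimately have "?u = 0" using dvd_imp_degree_le[of f ?u] by linarith
  hence "[:k:] = smult m r" by simp
  hence "Polynomial.coeff [:k:] 0 = Polynomial.coeff (smult m r) 0" by (rule arg_cong)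
  thus ?thesis by simp
qed

text \<open>
  If the image of the root under \<open>p\<close>-th power were not a root of \<open>f\<close>, it would be a root of
  the cofactor \<open>h\<close>. Differentiating \<open>f h = X\<^sup>d - 1\<close> there and using that \<open>f(w\<^sup>p)\<close> is
  divisible by \<open>p\<close> in \<open>\<int>[w]\<close> would then give \<open>p dvd d\<close>.
\<close>

lemma ev_prime_power_root:
  assumes fh: "f * h = Polynomial.monom 1 d - 1" and d: "d > 0"
    and w: "w ^ d = 1" "ev w f = 0" and p: "prime p" "\<not> p dvd d"
  shows "ev (w ^ p) f = 0"
proof (rule ccontr)
  assume nz: "ev (w ^ p) f \<noteq> 0"
  let ?v = "w ^ p"
  have vd: "?v ^ d = 1" using w by (metis power_commutes power_mult power_one mult.commute)
  have "ev ?v (f * h) = 0" using vd unfolding fh by simp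
  hence h0: "ev ?v h = 0" using nz by simp
  have "pderiv (f * h) = Polynomial.monom (of_nat d) (d - 1)"
    unfolding fh by (simp add: pderiv_diff pderiv_monom)
  hence "ev ?v (f * pderiv h + h * pderiv f) = of_nat d * ?v ^ (d - 1)"
    by (simp add: pderiv_mult del: ev_add ev_mult)
  \<comment> \<open>The extra factor \<open>?v\<close> completes \<open>?v ^ (d - 1)\<close> to
    \<open>?v ^ d = 1\<close>, which leaves the integer \<open>d\<close> alone on the right.\<close>
  hence "ev ?v f * ev ?v (pderiv h) * ?v = of_nat d * (?v ^ (d - 1) * ?v)"
    using h0 by (simp add: mult.assoc)
  also have "?v ^ (d - 1) * ?v = 1" using vd d by (metis power_minus_mult)
  finally have eq: "ev ?v f * ev ?v (pderiv h) * ?v = of_nat d" by simp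
  obtain h2 where h2: "ev w f ^ p = ev ?v f + of_nat p * ev w h2"
    using p(1) by (rule ev_frobenius)
  have "ev ?v f = - (of_nat p * ev w h2)"
    using h2 w(2) prime_gt_0_nat[OF p(1)] by (simp add: zero_power eq_neg_iff_add_eq_0)
  \<comment> \<open>Values at \<open>w ^ p\<close> are rewritten as values at \<open>w\<close>, so
    that the whole relation lives in Z[w].\<close>
  moreover have "ev ?v (pderiv h) = ev w (pderiv h \<circ>\<^sub>p Polynomial.monom 1 p)" by simp
  ultimately have "of_int (int d) =
      of_int (int p) * ev w (- (h2 * (pderiv h \<circ>\<^sub>p Polynomial.monom 1 p) * Polynomial.monom 1 p))"
    using eq by (simp add: algebra_simps)
  hence "int p dvd int d" using w(1) d by (intro dvd_if_eq_mult_ev[of w d])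
  thus False using p by simp
qed

text \<open>The prime factors of \<open>k\<close> do not divide \<open>d\<close> and are split off
  one at a time. Each changes the root from \<open>w\<close> to \<open>w ^ p\<close>, hence the
  induction over arbitrary \<open>w\<close>.\<close>

lemma ev_coprime_power_root:
  assumes fh: "f * h = Polynomial.monom 1 d - 1" and d: "d > 0"
    and "w ^ d = 1" "ev w f = 0" "coprime k d"
  shows "ev (w ^ k) f = 0"
  using assms(3-)
proof (induction k arbitrary: w rule: less_induct)
  case (less k)
  consider "k = 0" | "k = 1" | "k > 1" by linarith
  thus ?case
  proof cases
    case 3
    then obtain p where p: "prime p" "p dvd k" using prime_factor_nat[of k] by auto
    then obtain l where l: "k = p * l" by (auto elim!: dvdE)
    have "\<not> p dvd d" using p less.prems(3) coprime_common_divisor[of k d p] not_prime_unit by blast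
    hence "ev (w ^ p) f = 0" using ev_prime_power_root[OF fh d] less.prems p by blast
    moreover have "l < k" using l 3 prime_gt_1_nat[OF p(1)] by (intro n_less_m_mult_n[of l p, folded l]) (cases l; simp)+
    moreover have "(w ^ p) ^ d = 1"
      using less.prems(1) by (metis mult.commute power_mult power_one)
    moreover have "coprime l d" using less.prems(3) l by simp
    ultimately have "ev ((w ^ p) ^ l) f = 0" by (intro less.IH[of l "w ^ p"])
    thus ?thesis by (simp add: l power_mult)
  qed (use less.prems in auto)
qed

section \<open>Roots of unity and the degree of their minimal polynomial\<close>

lemma card_roots_ev_le:
  assumes "g \<noteq> 0"
  shows "finite {w. ev w g = 0}" "card {w. ev w g = 0} \<le> Polynomial.degree g"
proof -
  let ?G = "map_poly of_int g :: complex poly"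
  have G: "?G \<noteq> 0" "Polynomial.degree ?G = Polynomial.degree g"
    using assms by (auto simp: map_poly_eq_0_iff degree_map_poly)
  show "finite {w. ev w g = 0}" "card {w. ev w g = 0} \<le> Polynomial.degree g"
    unfolding ev_def using poly_roots_finite[OF G(1)] card_poly_roots_bound[OF G(1)] G(2) by simp_all
qed

locale primitive_root =
  fixes d :: nat and z :: complex
  assumes prim: "primitive_root_of_unity d z"
begin

lemma d_pos: "d > 0" and pow_d: "z ^ d = 1" and pow_neq_1: "0 < k \<Longrightarrow> k < d \<Longrightarrow> z ^ k \<noteq> 1"
  using prim by (auto simp: primitive_root_of_unity_def)

lemma z_nz: "z \<noteq> 0"
  using pow_d d_pos by (auto simp: zero_power)

lemma inj_on_power: "inj_on (\<lambda>k. z ^ k) {0<..d}"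
proof -
  have "False" if "i \<in> {0<..d}" "j \<in> {0<..d}" "z ^ i = z ^ j" "i < j" for i j
  proof -
    have "z ^ j = z ^ i * z ^ (j - i)" using that(4) by (simp flip: power_add)
    hence "z ^ (j - i) = 1" using that(3) z_nz by simp
    moreover have "0 < j - i" "j - i < d" using that by auto
    ultimately show False using pow_neq_1 by blast
  qed
  thus ?thesis by (intro inj_onI) (metis linorder_neqE_nat)
qed

text \<open>The \<open>d\<close> distinct powers of \<open>z\<close> already exhaust the number of
  roots that X^d - 1 can have. The exponents run from 1 to \<open>d\<close> to match
  \<open>totatives\<close>.\<close>

lemma roots_of_unity_eq: "{w. w ^ d = 1} = (\<lambda>k. z ^ k) ` {0<..d}"
proof (rule sym, rule card_seteq)
  have F: "Polynomial.monom 1 d - 1 \<noteq> (0 :: int poly)"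
    using lead_coeff_monom_minus_1[OF d_pos] by force
  have eq: "{w. w ^ d = 1} = {w. ev w (Polynomial.monom 1 d - 1) = 0}" by simp
  show "finite {w :: complex. w ^ d = 1}" unfolding eq by (rule card_roots_ev_le[OF F])
  have "card {w :: complex. w ^ d = 1} \<le> d"
    using card_roots_ev_le(2)[OF F] unfolding eq lead_coeff_monom_minus_1[OF d_pos] .
  thus "card {w :: complex. w ^ d = 1} \<le> card ((\<lambda>k. z ^ k) ` {0<..d})"
    by (simp add: card_image[OF inj_on_power])
  show "(\<lambda>k. z ^ k) ` {0<..d} \<subseteq> {w. w ^ d = 1}"
  proof (intro image_subsetI CollectI)
    fix k
    have "(z ^ k) ^ d = (z ^ d) ^ k" by (metis mult.commute power_mult)
    thus "(z ^ k) ^ d = 1" by (simp add: pow_d)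
  qed
qed

text \<open>This is the irreducibility of the cyclotomic polynomial: \<open>f\<close> has simple
  roots, and these are exactly the powers of \<open>z\<close> with exponent coprime to
  \<open>d\<close>.\<close>

lemma degree_minimal_poly:
  assumes "minimal_int_poly z f"
  shows "Polynomial.degree f = totient d"
proof -
  note f = minimal_int_polyD(1,3)[OF assms]
  let ?F = "Polynomial.monom 1 d - 1 :: int poly"
  let ?Z = "\<lambda>g. {w. ev w g = 0}"
  have F: "?F \<noteq> 0" using lead_coeff_monom_minus_1[OF d_pos] by force
  have "ev z ?F = 0" by (simp add: pow_d)
  hence "f dvd ?F" unfolding f(2) .
  then obtain h where h: "?F = f * h" by (rule dvdE)
  have nz: "f \<noteq> 0" "h \<noteq> 0" using F unfolding h by auto
  have fz: "ev z f = 0" unfolding f(2) by (rule dvd_refl)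
  have "Polynomial.degree (f * h) = d" using lead_coeff_monom_minus_1(2)[OF d_pos] unfolding h .
  hence deg: "d = Polynomial.degree f + Polynomial.degree h"
    using nz by (simp add: degree_mult_eq)
  have Z: "?Z f \<union> ?Z h = {w. w ^ d = 1}"
  proof -
    have "w ^ d = 1 \<longleftrightarrow> ev w f = 0 \<or> ev w h = 0" for w
    proof -
      have "w ^ d - 1 = ev w ?F" by simp
      also have "\<dots> = ev w f * ev w h" unfolding h by simp
      finally show ?thesis by (metis eq_iff_diff_eq_0 mult_eq_0_iff)
    qed
    thus ?thesis by blast
  qed
  have "d = card (?Z f \<union> ?Z h)"
    unfolding Z roots_of_unity_eq by (simp add: card_image[OF inj_on_power])
  also have "\<dots> \<le> card (?Z f) + card (?Z h)" by (rule card_Un_le)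
  \<comment> \<open>The root counts of \<open>f\<close> and \<open>h\<close> are at most their
    degrees, which add up to \<open>d\<close>; hence both bounds are attained.\<close>
  finally have cardf: "card (?Z f) = Polynomial.degree f"
    using deg card_roots_ev_le(2)[OF nz(1)] card_roots_ev_le(2)[OF nz(2)] by linarith
  have "?Z f = (\<lambda>k. z ^ k) ` totatives d"
  proof (intro equalityI subsetI)
    fix w assume "w \<in> (\<lambda>k. z ^ k) ` totatives d"
    then obtain k where "w = z ^ k" "coprime k d" by (auto simp: totatives_def)
    thus "w \<in> ?Z f" using ev_coprime_power_root[OF h[symmetric] d_pos pow_d fz] by simp
  next
    fix w assume w: "w \<in> ?Z f"
    hence "w ^ d = 1" using Z by auto
    then obtain k where k: "w = z ^ k" "k \<in> {0<..d}" using roots_of_unity_eq by blast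
    have "coprime k d"
    proof (rule ccontr)
      assume nc: "\<not> coprime k d"
      define e where "e = gcd k d"
      have "e \<noteq> 1" "e \<noteq> 0" using nc d_pos by (auto simp: e_def coprime_iff_gcd_eq_1)
      hence "e > 1" by linarith
      have e: "e dvd k" "e dvd d" unfolding e_def by auto
      obtain a where a: "k = e * a" using e(1) by (rule dvdE)
      obtain b where b: "d = e * b" using e(2) by (rule dvdE)
      have b0: "b > 0" using b d_pos by (cases b) auto
      have "b < d" using n_less_m_mult_n[of b e] b0 \<open>e > 1\<close> unfolding b by simp
      note de = b0 this
      have "w ^ b = z ^ (k * b)" by (simp add: k power_mult)
      also have "k * b = d * a" unfolding a b by simp
      finally have we: "w ^ b = 1" by (simp add: power_mult pow_d)
      obtain q where "minimal_int_poly w q"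
        using we de(1) by (rule root_of_unity_minimal_poly)
  note q = minimal_int_polyD[OF this]
      have "ev w f = 0" using w by simp
      hence "q dvd f" unfolding q(3) .
      then obtain r where r: "f = q * r" by (rule dvdE)
      have "ev z q * ev z r = 0" using fz r by simp
      \<comment> \<open>One factor vanishes at \<open>z\<close>. If it is \<open>q\<close>, then
        \<open>z\<close> has order at most \<open>b < d\<close>; if it is \<open>r\<close>, the
        degree of \<open>q\<close> leaves no room.\<close>
      hence "f dvd q \<or> f dvd r" unfolding f(2)[symmetric] by simp
      thus False
      proof
        assume "f dvd q"
        moreover have "q dvd Polynomial.monom 1 b - 1"
          unfolding q(3)[symmetric] by (simp add: we)
        ultimately have "f dvd Polynomial.monom 1 b - 1" by (rule dvd_trans)
        hence "ev z (Polynomial.monom 1 b - 1) = 0" unfolding f(2) .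
        thus False using pow_neq_1 de by simp
      next
        assume "f dvd r"
        moreover have "r \<noteq> 0" "q \<noteq> 0" using nz r by auto
        moreover from this have "Polynomial.degree f = Polynomial.degree q + Polynomial.degree r"
          unfolding r by (simp add: degree_mult_eq)
        ultimately show False using dvd_imp_degree_le[of f r] q(4) by linarith
      qed
    qed
    thus "w \<in> (\<lambda>k. z ^ k) ` totatives d" using k by (auto simp: totatives_def)
  qed
  moreover have "inj_on (\<lambda>k. z ^ k) (totatives d)"
    by (rule inj_on_subset[OF inj_on_power]) (auto simp: totatives_def)
  ultimately show ?thesis using cardf by (metis card_image totient_def)
qed

end

section \<open>Subfields of the complex numbers\<close>

interpretation C: cring complex_ring
  by (rule cring_from_type_algebra)

lemma complex_ring_simps [simp]:
  "carrier complex_ring = UNIV" "x \<otimes>\<^bsub>complex_ring\<^esub> y = x * y" "x \<oplus>\<^bsub>complex_ring\<^esub> y = x + y"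
  "\<one>\<^bsub>complex_ring\<^esub> = 1" "\<zero>\<^bsub>complex_ring\<^esub> = 0"
  by (simp_all add: ring_of_type_algebra_def)

lemma complex_ring_minus [simp]: "\<ominus>\<^bsub>complex_ring\<^esub> x = - x"
  by (rule C.minus_equality) simp_all

lemma complex_ring_inv: "x \<noteq> 0 \<Longrightarrow> inv\<^bsub>complex_ring\<^esub> x = inverse x"
  by (rule C.comm_inv_char) simp_all

lemma subfield_complexI:
  assumes "1 \<in> K" "\<And>x. x \<in> K \<Longrightarrow> - x \<in> K" "\<And>x y. x \<in> K \<Longrightarrow> y \<in> K \<Longrightarrow> x + y \<in> K"
    "\<And>x y. x \<in> K \<Longrightarrow> y \<in> K \<Longrightarrow> x * y \<in> K" "\<And>x. x \<in> K \<Longrightarrow> x \<noteq> 0 \<Longrightarrow> inverse x \<in> K"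
  shows "subfield K complex_ring"
  by (rule field.subfieldI'[OF field_complex_ring], rule C.subringI) (use assms complex_ring_inv in auto)

locale complex_subfield =
  fixes K :: "complex set"
  assumes subfield: "subfield K complex_ring"
begin

lemma zero [simp]: "0 \<in> K" and one [simp]: "1 \<in> K"
  using subringE(2,3)[OF subfieldE(1)[OF subfield]] by simp_all

lemma add [intro]: "x \<in> K \<Longrightarrow> y \<in> K \<Longrightarrow> x + y \<in> K"
  using subringE(7)[OF subfieldE(1)[OF subfield], of x y] by simp

lemma mult [intro]: "x \<in> K \<Longrightarrow> y \<in> K \<Longrightarrow> x * y \<in> K"
  using subringE(6)[OF subfieldE(1)[OF subfield], of x y] by simp

lemma minus [intro]: "x \<in> K \<Longrightarrow> - x \<in> K"
  using subringE(5)[OF subfieldE(1)[OF subfield], of x] by simp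

lemma inverse [intro]: "x \<in> K \<Longrightarrow> inverse x \<in> K"
  using C.subfield_m_inv(1)[OF subfield, of x] complex_ring_inv[of x] by (cases "x = 0") auto

lemma diff [intro]: "x \<in> K \<Longrightarrow> y \<in> K \<Longrightarrow> x - y \<in> K"
  using add[of x "- y"] minus[of y] by simp

lemma divide [intro]: "x \<in> K \<Longrightarrow> y \<in> K \<Longrightarrow> x / y \<in> K"
  by (simp add: divide_inverse mult inverse)

lemma power [intro]: "x \<in> K \<Longrightarrow> x ^ k \<in> K"
  by (induction k) auto

lemma prod [intro]: "(\<And>a. a \<in> A \<Longrightarrow> f a \<in> K) \<Longrightarrow> prod f A \<in> K"
  by (induction A rule: infinite_finite_induct) auto

lemma of_nat [simp, intro]: "of_nat n \<in> K"
  by (induction n) auto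

lemma of_int [simp, intro]: "of_int n \<in> K"
  by (cases n rule: int_cases2) auto

lemma Rats_subset: "\<rat> \<subseteq> K"
proof
  fix x :: complex assume "x \<in> \<rat>"
  then obtain a b where "x = of_int a / of_int b" by (rule Rats_cases')
  thus "x \<in> K" by auto
qed

lemma ev_in [intro]: "z \<in> K \<Longrightarrow> ev z g \<in> K"
  by (induction g) auto

text \<open>Square roots differ only by sign, so membership does not depend on the chosen
  branch.\<close>

lemma square_root_in:
  assumes "y \<in> K" "y ^ 2 = x ^ 2"
  shows "x \<in> K"
  using assms minus[of "- x"] by (auto simp: power2_eq_iff)

lemma adjoin_Q_subset:
  assumes "A \<subseteq> K"
  shows "adjoin_Q A \<subseteq> K"
  unfolding adjoin_Q_def using assms Rats_subset
  by (intro field.generate_field_min_subfield1[OF field_complex_ring] subfield) auto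

end

lemma complex_subfield_Rats: "complex_subfield \<rat>"
  by (rule complex_subfield.intro, rule subfield_complexI) simp_all

lemma complex_subfield_adjoin_Q: "complex_subfield (adjoin_Q A)"
  by (rule complex_subfield.intro) (rule subfield_adjoin_Q)

lemma subset_adjoin_Q: "A \<subseteq> adjoin_Q A"
  unfolding adjoin_Q_def by (auto intro: generate_field.incl)

section \<open>The cyclotomic field and its dimension\<close>

text \<open>This is Q[z] written with a common integer denominator, so that only integer polynomials
  occur.\<close>

definition rat_poly_values :: "complex \<Rightarrow> complex set" where
  "rat_poly_values z = {x. \<exists>M g. M \<noteq> 0 \<and> x = ev z g / of_int M}"

lemma rat_poly_valuesI: "M \<noteq> 0 \<Longrightarrow> of_int M * x = ev z g \<Longrightarrow> x \<in> rat_poly_values z"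
  unfolding rat_poly_values_def by (auto intro!: exI[of _ M] exI[of _ g] simp: field_simps)

lemma rat_poly_valuesE:
  assumes "x \<in> rat_poly_values z"
  obtains M g where "M \<noteq> 0" "of_int M * x = ev z g"
  using assms unfolding rat_poly_values_def by auto

text \<open>A Bezout identity with cleared denominators: a nonzero combination of \<open>g\<close>
  and \<open>f\<close> of least degree turns out to be a constant.\<close>

lemma ev_inverse:
  assumes min_f: "minimal_int_poly z f" and g: "ev z g \<noteq> 0"
  obtains a M where "M \<noteq> 0" "ev z a * ev z g = of_int M"
proof -
  note f = minimal_int_polyD(4,3)[OF min_f]
  define I where "I = {u. u \<noteq> 0 \<and> (\<exists>a b. u = a * g + b * f)}"
  have f0: "f \<noteq> 0" using f by auto
  moreover have "f = 0 * g + 1 * f" by simp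
  ultimately have "f \<in> I" unfolding I_def by blast
  then obtain u where u: "u \<in> I" and min: "\<And>v. v \<in> I \<Longrightarrow> Polynomial.degree u \<le> Polynomial.degree v"
    using ex_has_least_nat[of "\<lambda>u. u \<in> I" f Polynomial.degree] by blast
  obtain a b where ab: "u = a * g + b * f" and u0: "u \<noteq> 0" using u by (auto simp: I_def)
  \<comment> \<open>By minimality of its degree, \<open>u\<close> divides each combination up to an
    integer factor.\<close>
  have div: "\<exists>c q. c \<noteq> 0 \<and> smult c v = u * q" if v: "v = a' * g + b' * f" for v a' b'
  proof -
    obtain c q where cq: "c \<noteq> 0" "smult c v = u * q + pseudo_mod v u"
      using pseudo_mod(1)[OF u0] by blast
    have "pseudo_mod v u = smult c v - u * q" using cq by simp
    also have "\<dots> = (smult c a' - a * q) * g + (smult c b' - b * q) * f"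
      unfolding v ab by (simp add: algebra_simps smult_add_right)
    finally have "pseudo_mod v u \<noteq> 0 \<Longrightarrow> pseudo_mod v u \<in> I" unfolding I_def by blast
    hence "pseudo_mod v u = 0" using pseudo_mod(2)[OF u0, of v] min by fastforce
    thus ?thesis using cq by auto
  qed
  obtain c q where cq: "c \<noteq> 0" "smult c f = u * q" using div[of f 0 1] by auto
  obtain c' q' where cq': "c' \<noteq> 0" "smult c' g = u * q'" using div[of g 1 0] by auto
  have "ev z u \<noteq> 0"
  proof
    assume "ev z u = 0"
    hence "ev z (u * q') = 0" by simp
    hence "ev z (smult c' g) = 0" unfolding cq'(2) .
    thus False using cq'(1) g by simp
  qed
  moreover have "ev z f = 0" unfolding f(2) by (rule dvd_refl)
  hence "ev z (smult c f) = 0" by simp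
  hence "ev z (u * q) = 0" unfolding cq .
  \<comment> \<open>Since \<open>u\<close> does not vanish at \<open>z\<close>, the cofactor
    \<open>q\<close> does. It then has at least the degree of \<open>f\<close>, which leaves degree
    0 for \<open>u\<close>.\<close>
  ultimately have "f dvd q" using f(2)[of q] by simp
  moreover have q0: "q \<noteq> 0" using cq f0 by auto
  ultimately have "Polynomial.degree f \<le> Polynomial.degree q" by (rule dvd_imp_degree_le)
  moreover have "Polynomial.degree f = Polynomial.degree (u * q)"
    using cq by (metis degree_smult_eq)
  ultimately have "Polynomial.degree u = 0" using u0 q0 by (simp add: degree_mult_eq)
  then obtain M where M: "u = [:M:]" using degree_eq_zeroE by blast
  have "ev z a * ev z g = ev z u" unfolding ab using \<open>ev z f = 0\<close> by simp
  also have "\<dots> = of_int M" by (simp add: M)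
  finally show ?thesis using that[of M a] M u0 by auto
qed

lemma subfield_rat_poly_values:
  assumes z: "z ^ d = 1" "d > 0"
  shows "complex_subfield (rat_poly_values z)"
proof (rule complex_subfield.intro, rule subfield_complexI)
  show "1 \<in> rat_poly_values z" by (rule rat_poly_valuesI[of 1 _ _ 1]) simp_all
next
  fix x assume "x \<in> rat_poly_values z"
  then obtain M g where "M \<noteq> 0" "of_int M * x = ev z g" by (rule rat_poly_valuesE)
  thus "- x \<in> rat_poly_values z" by (intro rat_poly_valuesI[of M _ _ "- g"]) auto
next
  fix x y assume "x \<in> rat_poly_values z" "y \<in> rat_poly_values z"
  then obtain M g N h where *: "M \<noteq> 0" "of_int M * x = ev z g" "N \<noteq> 0" "of_int N * y = ev z h"
    by (elim rat_poly_valuesE)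
  thus "x * y \<in> rat_poly_values z"
    by (intro rat_poly_valuesI[of "M * N" _ _ "g * h"]) (auto simp flip: *(2,4))
  show "x + y \<in> rat_poly_values z" using *
    by (intro rat_poly_valuesI[of "M * N" _ _ "smult N g + smult M h"])
      (auto simp: algebra_simps simp flip: *(2,4))
next
  fix x assume "x \<in> rat_poly_values z" and x: "x \<noteq> 0"
  then obtain M g where M: "M \<noteq> 0" "of_int M * x = ev z g" by (elim rat_poly_valuesE)
  obtain f where "minimal_int_poly z f"
    using z by (rule root_of_unity_minimal_poly)
  note f = minimal_int_polyD[OF this]
  have "ev z g \<noteq> 0" using M x by (metis mult_eq_0_iff of_int_eq_0_iff)
  then obtain a N where N: "N \<noteq> 0" "ev z a * ev z g = of_int N"
    using ev_inverse[OF \<open>minimal_int_poly z f\<close>] by blast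
  have "ev z a * of_int M * x = of_int N" using N(2) unfolding M(2)[symmetric] by (simp add: mult.assoc)
  hence "of_int N * inverse x = ev z (smult M a)" using x by (simp add: field_simps)
  thus "inverse x \<in> rat_poly_values z" using N by (intro rat_poly_valuesI)
qed

lemma adjoin_root_of_unity_eq:
  assumes z: "z ^ d = 1" "d > 0"
  shows "adjoin_Q {z} = rat_poly_values z"
proof
  interpret V: complex_subfield "rat_poly_values z" by (rule subfield_rat_poly_values[OF z])
  have "z \<in> rat_poly_values z" by (rule rat_poly_valuesI[of 1 _ _ "[:0, 1:]"]) simp_all
  thus "adjoin_Q {z} \<subseteq> rat_poly_values z" by (intro V.adjoin_Q_subset) auto
  interpret K: complex_subfield "adjoin_Q {z}" by (rule complex_subfield_adjoin_Q)
  have "ev z g / of_int M \<in> adjoin_Q {z}" for g M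
    using subset_adjoin_Q[of "{z}"] by (intro K.divide K.ev_in K.of_int) auto
  thus "rat_poly_values z \<subseteq> adjoin_Q {z}" by (auto simp: rat_poly_values_def)
qed

context primitive_root
begin

lemma dimension_adjoin_Q: "ring.dimension complex_ring (totient d) \<rat> (adjoin_Q {z})"
proof -
  obtain f where "minimal_int_poly z f"
    using pow_d d_pos by (rule root_of_unity_minimal_poly)
  note f = minimal_int_polyD[OF this]
  have deg: "Polynomial.degree f = totient d" using \<open>minimal_int_poly z f\<close> by (rule degree_minimal_poly)
  \<comment> \<open>\<open>V j\<close> is the rational span of the powers of \<open>z\<close> below
    \<open>j\<close>. This filtration fits the inductive definition of dimension by line
    extensions.\<close>
  define V where "V j = {x. \<exists>M g. M \<noteq> 0 \<and> of_int M * x = ev z g \<and> (\<forall>i\<ge>j. Polynomial.coeff g i = 0)}" for j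
  have VI: "x \<in> V j" if "M \<noteq> 0" "of_int M * x = ev z g" "\<And>i. i \<ge> j \<Longrightarrow> Polynomial.coeff g i = 0" for M g x j
    unfolding V_def by (intro CollectI exI[of _ M] exI[of _ g] conjI allI impI that)
  have V0: "V 0 = {0}"
  proof -
    have "x = 0" if "x \<in> V 0" for x
    proof -
      from that obtain M g where "M \<noteq> 0" "of_int M * x = ev z g" "\<forall>i. Polynomial.coeff g i = 0"
        by (auto simp: V_def)
      moreover from this have "g = 0" by (simp add: poly_eq_iff)
      ultimately show "x = 0" by simp
    qed
    moreover have "0 \<in> V 0"
      unfolding V_def by (intro CollectI exI[of _ "1 :: int"] exI[of _ "0 :: int poly"]) simp
    ultimately show ?thesis by auto
  qed
  have V_Suc: "V (Suc j) = C.line_extension \<rat> (z ^ j) (V j)" for j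
  proof (intro equalityI subsetI)
    fix x assume "x \<in> V (Suc j)"
    then obtain M g where g: "M \<noteq> 0" "of_int M * x = ev z g" "\<forall>i\<ge>Suc j. Polynomial.coeff g i = 0"
      by (auto simp: V_def)
    define c where "c = Polynomial.coeff g j"
    define h where "h = g - Polynomial.monom c j"
    have "Polynomial.coeff h i = 0" if "i \<ge> j" for i
      using g(3) that unfolding h_def c_def by (cases "i = j") auto
    moreover have "of_int M * (x - (of_int c / of_int M) * z ^ j) = ev z h"
      using g(1) by (simp add: h_def right_diff_distrib g(2))
    ultimately have "x - (of_int c / of_int M) * z ^ j \<in> V j" using g(1) by (intro VI[of M _ h])
    moreover have "of_int c / of_int M \<in> (\<rat> :: complex set)" by simp
    ultimately show "x \<in> C.line_extension \<rat> (z ^ j) (V j)"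
      unfolding C.line_extension_mem_iff
      by (intro bexI[of _ "of_int c / of_int M"] bexI[of _ "x - (of_int c / of_int M) * z ^ j"]) simp_all
  next
    fix x assume "x \<in> C.line_extension \<rat> (z ^ j) (V j)"
    then obtain k v where kv: "k \<in> \<rat>" "v \<in> V j" "x = k * z ^ j + v"
      unfolding C.line_extension_mem_iff complex_ring_simps by blast
    obtain M g where g: "M \<noteq> 0" "of_int M * v = ev z g" "\<forall>i\<ge>j. Polynomial.coeff g i = 0"
      using kv(2) unfolding V_def by blast
    obtain a b where ab: "b > 0" "k = of_int a / of_int b" using kv(1) by (rule Rats_cases')
    have "of_int (b * M) * x = ev z (Polynomial.monom (a * M) j + smult b g)"
    proof -
      have "of_int (b * M) * x = of_int M * (of_int b * k) * z ^ j + of_int b * (of_int M * v)"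
        unfolding kv(3) by (simp add: algebra_simps)
      also have "of_int b * k = of_int a" using ab by simp
      finally show ?thesis unfolding g(2) by simp
    qed
    moreover have "Polynomial.coeff (Polynomial.monom (a * M) j + smult b g) i = 0" if "i \<ge> Suc j" for i
      using g(3) that by simp
    moreover have "b * M \<noteq> 0" using ab g by simp
    ultimately show "x \<in> V (Suc j)" by (intro VI[of "b * M" _ "Polynomial.monom (a * M) j + smult b g"])
  qed
  \<comment> \<open>A relation would give a nonzero polynomial of degree at most \<open>j\<close>,
    less than the degree of \<open>f\<close>, vanishing at \<open>z\<close>.\<close>
  have notin: "z ^ j \<notin> V j" if "j < totient d" for j
  proof
    assume "z ^ j \<in> V j"
    then obtain M g where g: "M \<noteq> 0" "of_int M * z ^ j = ev z g" "\<forall>i\<ge>j. Polynomial.coeff g i = 0"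
      by (auto simp: V_def)
    let ?u = "Polynomial.monom M j - g"
    have "ev z ?u = 0" by (simp add: g(2))
    hence "f dvd ?u" unfolding f(3) .
    moreover have "Polynomial.coeff ?u j = M" using g(3) by simp
    hence "?u \<noteq> 0" using g(1) by (metis coeff_0)
    moreover have "Polynomial.degree ?u \<le> j"
      using g(3) by (intro degree_le) auto
    ultimately show False using dvd_imp_degree_le[of f ?u] that deg by linarith
  qed
  have "C.dimension j \<rat> (V j)" if "j \<le> totient d" for j
    using that
  proof (induction j)
    case 0
    then show ?case unfolding V0 using C.zero_dim[of \<rat>] by simp
  next
    case (Suc j)
    then show ?case unfolding V_Suc using notin[of j] by (intro C.Suc_dim) auto
  qed
  moreover have "V (totient d) = adjoin_Q {z}"
    unfolding adjoin_root_of_unity_eq[OF pow_d d_pos]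
  proof (intro equalityI subsetI)
    fix x assume "x \<in> rat_poly_values z"
    then obtain M g where M: "M \<noteq> 0" "of_int M * x = ev z g" by (rule rat_poly_valuesE)
    obtain r where r: "ev z r = ev z g" "Polynomial.degree r < Polynomial.degree f"
      using f(1,4,2) by (rule ev_eq_mod_monic)
    have "Polynomial.coeff r i = 0" if "i \<ge> totient d" for i
      using r(2) deg that by (intro coeff_eq_0) simp
    thus "x \<in> V (totient d)" using M by (intro VI[of M _ r]) (simp_all add: r(1))
  next
    fix x assume "x \<in> V (totient d)"
    then obtain M g where "M \<noteq> 0" "of_int M * x = ev z g" unfolding V_def by blast
    thus "x \<in> rat_poly_values z" by (rule rat_poly_valuesI)
  qed
  ultimately show ?thesis by (metis order_refl)
qed

end

section \<open>Integers that are squares in a cyclotomic field\<close>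

lemma ev_frobenius_iterate:
  assumes p: "prime p"
  shows "\<exists>h. ev w g ^ (p ^ j) = ev (w ^ (p ^ j)) g + of_nat p * ev w h"
proof (induction j arbitrary: w)
  case 0
  show ?case by (intro exI[of _ 0]) simp
next
  case (Suc j)
  obtain h where h: "ev w (g ^ (p ^ j)) ^ p = ev (w ^ p) (g ^ (p ^ j)) + of_nat p * ev w h"
    using p by (rule ev_frobenius)
  obtain k where k: "ev (w ^ p) g ^ (p ^ j) = ev ((w ^ p) ^ (p ^ j)) g + of_nat p * ev (w ^ p) k"
    using Suc.IH by blast
  have "ev w g ^ (p ^ Suc j) = ev w (g ^ (p ^ j)) ^ p"
    by (simp add: power_mult[symmetric] mult.commute)
  also have "\<dots> = ev ((w ^ p) ^ (p ^ j)) g + of_nat p * ev w (k \<circ>\<^sub>p Polynomial.monom 1 p + h)"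
    unfolding h using k by (simp add: algebra_simps)
  also have "(w ^ p) ^ (p ^ j) = w ^ (p ^ Suc j)" by (simp add: power_mult)
  finally show ?case by blast
qed

text \<open>
  Some power \<open>p\<^sup>j\<close> is \<open>1\<close> modulo \<open>d\<close>, so \<open>x \<mapsto> x\<^sup>p\<^sup>j\<close> is the identity on \<open>\<int>[w]/p\<close>;
  in particular that ring is reduced.
\<close>

lemma prime_dvd_ev_if_dvd_square:
  assumes w: "w ^ d = 1" and d: "d > 0" and p: "prime p" "\<not> p dvd d"
    and sq: "ev w g ^ 2 = of_nat p * ev w h"
  shows "\<exists>k. ev w g = of_nat p * ev w k"
proof -
  define j where "j = totient d"
  have "coprime p d" using p by (simp add: prime_imp_coprime)
  hence "[p ^ j = 1] (mod d)" unfolding j_def by (rule euler_theorem)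
  moreover have p1: "p ^ j \<ge> 1" using prime_gt_0_nat[OF p(1)] by simp
  ultimately have "d dvd p ^ j - 1" using cong_altdef_nat[of 1 "p ^ j" d] by blast
  then obtain q where q: "p ^ j - 1 = d * q" by (rule dvdE)
  have "w ^ (p ^ j) = w ^ (d * q + 1)" using q p1 by (metis le_add_diff_inverse2)
  also have "\<dots> = w" using w by (simp add: power_add power_mult)
  finally have wpj: "w ^ (p ^ j) = w" .
  obtain k where k: "ev w g ^ (p ^ j) = ev w g + of_nat p * ev w k"
    using ev_frobenius_iterate[OF p(1), of w g j] unfolding wpj by blast
  \<comment> \<open>This makes the exponent \<open>p ^ j\<close> at least 2, so that the square of
    \<open>ev w g\<close> can be split off.\<close>
  have "j > 0" using d by (simp add: j_def)
  hence "p ^ 1 \<le> p ^ j" using prime_gt_0_nat[OF p(1)] by (intro power_increasing) auto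
  hence "2 \<le> p ^ j" using prime_ge_2_nat[OF p(1)] by simp
  hence "ev w g ^ (p ^ j) = ev w g ^ 2 * ev w g ^ (p ^ j - 2)"
    by (metis le_add_diff_inverse power_add)
  also have "\<dots> = of_nat p * ev w (h * g ^ (p ^ j - 2))" unfolding sq by simp
  finally have "ev w g = of_nat p * ev w (h * g ^ (p ^ j - 2) - k)"
    using k by (simp add: algebra_simps)
  thus ?thesis by blast
qed

text \<open>Infinite descent: reducedness modulo \<open>p\<close> makes \<open>ev w g\<close>
  divisible by \<open>p\<close>, which forces \<open>p\<close> to divide \<open>M\<close>. Dividing
  both by \<open>p\<close> gives an equation of the same form with smaller \<open>M\<close>.\<close>

lemma ev_square_neq_mult_square:
  fixes s :: int
  assumes w: "w ^ d = 1" and d: "d > 0" and p: "prime p" "\<not> p dvd d"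
    and s: "\<not> int p dvd s"
  shows "M \<noteq> 0 \<Longrightarrow> ev w g ^ 2 \<noteq> of_int (int p * s * M ^ 2)"
proof (induction "nat \<bar>M\<bar>" arbitrary: M g rule: less_induct)
  case less
  have p0: "p > 0" using prime_gt_0_nat[OF p(1)] .
  show ?case
  proof
    assume eq: "ev w g ^ 2 = of_int (int p * s * M ^ 2)"
    hence "ev w g ^ 2 = of_nat p * ev w [:s * M ^ 2:]" by simp
    then obtain k where k: "ev w g = of_nat p * ev w k"
      using prime_dvd_ev_if_dvd_square[OF w d p] by blast
    have "of_nat p * (of_nat p * ev w k ^ 2) = of_nat p * of_int (s * M ^ 2)"
      using eq unfolding k by (simp add: power2_eq_square mult_ac)
    hence eq2: "of_int (s * M ^ 2) = of_int (int p) * ev w (k ^ 2)" using p0 by simp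
    hence "int p dvd s * M ^ 2" using w d by (intro dvd_if_eq_mult_ev[of w d])
    hence "int p dvd M" using s p(1) by (metis prime_dvd_multD prime_dvd_power prime_nat_int_transfer)
    then obtain N where N: "M = int p * N" by (rule dvdE)
    have "N \<noteq> 0" using less.prems N by auto
    moreover have "nat \<bar>N\<bar> < nat \<bar>M\<bar>"
    proof -
      have "1 * \<bar>N\<bar> < int p * \<bar>N\<bar>" using \<open>N \<noteq> 0\<close> prime_gt_1_nat[OF p(1)]
        by (intro mult_strict_right_mono) auto
      thus ?thesis by (simp add: N abs_mult)
    qed
    moreover have "of_nat p * of_int (int p * s * N ^ 2) = (of_nat p * ev w k ^ 2 :: complex)"
      using eq2 unfolding N by (simp add: power2_eq_square mult_ac)
    hence "ev w k ^ 2 = of_int (int p * s * N ^ 2)" using p0 by simp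
    ultimately show False using less.hyps by blast
  qed
qed

lemma sqf_decomposition:
  fixes m :: int
  assumes "m \<noteq> 0"
  obtains c where "m = sqf m * c ^ 2" "c \<noteq> 0" "squarefree (sqf m)" "sqf m \<noteq> 0"
proof -
  from sqf_unique[OF assms, of "sqf m"] obtain c where c: "squarefree (sqf m)" "m = sqf m * c ^ 2" by auto
  moreover have "c \<noteq> 0" "sqf m \<noteq> 0" using c(2) assms by auto
  ultimately show ?thesis using that by blast
qed

section \<open>Square roots of odd integers from roots of unity\<close>

text \<open>Evaluate 1 + X + ... + X^(t-1), which is the product of the factors X - w^k, at
  1.\<close>

lemma prod_one_minus_root_of_unity_powers:
  assumes "primitive_root_of_unity t w"
  shows "(\<Prod>k=1..<t. 1 - w ^ k) = of_nat t"
proof -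
  interpret primitive_root t w by unfold_locales (rule assms)
  define P where "P = (\<Sum>k<t. Polynomial.monom (1::complex) k)"
  define Q where "Q = (\<Prod>k=1..<t. [:- (w ^ k), 1:])"
  have coeffP: "Polynomial.coeff P k = (if k < t then 1 else 0)" for k
    by (simp add: P_def coeff_sum)
  have degQ: "Polynomial.degree Q = t - 1" unfolding Q_def by (subst degree_prod_eq_sum_degree) auto
  have lcQ: "Polynomial.lead_coeff Q = 1" unfolding Q_def lead_coeff_prod by simp
  have inj: "inj_on (\<lambda>k. w ^ k) {1..<t}"
    by (rule inj_on_subset[OF inj_on_power]) auto
  have rootP: "poly P (w ^ k) = 0" if "k \<in> {1..<t}" for k
  proof -
    have "(w ^ k - 1) * poly P (w ^ k) = (w ^ k) ^ t - 1"
      by (simp add: P_def poly_sum poly_monom power_diff_1_eq)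
    also have "(w ^ k) ^ t = (w ^ t) ^ k" by (metis mult.commute power_mult)
    finally have "(w ^ k - 1) * poly P (w ^ k) = 0" by (simp add: pow_d)
    moreover have "w ^ k \<noteq> 1" using that pow_neq_1 by auto
    ultimately show ?thesis by simp
  qed
  have rootQ: "poly Q (w ^ k) = 0" if "k \<in> {1..<t}" for k
    using that unfolding Q_def poly_prod by (intro prod_zero) auto
  have "P = Q"
  proof (rule ccontr)
    assume "P \<noteq> Q"
    hence nz: "P - Q \<noteq> 0" by simp
    \<comment> \<open>Both polynomials are monic of degree \<open>t - 1\<close>, so their difference
      has too small a degree for its \<open>t - 1\<close> roots.\<close>
    have "Polynomial.coeff (P - Q) i = 0" if "i \<ge> t - 1" for i
      using that lcQ degQ d_pos coeffP by (cases "i = t - 1") (auto simp: coeff_eq_0)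
    hence "Polynomial.degree (P - Q) < t - 1"
      using nz by (metis leading_coeff_0_iff not_le)
    moreover have "card ((\<lambda>k. w ^ k) ` {1..<t}) \<le> card {x. poly (P - Q) x = 0}"
      using rootP rootQ by (intro card_mono poly_roots_finite nz) auto
    moreover have "card ((\<lambda>k. w ^ k) ` {1..<t}) = t - 1" using card_image[OF inj] by simp
    ultimately show False using card_poly_roots_bound[OF nz] by linarith
  qed
  have "(\<Prod>k=1..<t. 1 - w ^ k) = poly Q 1" by (simp add: Q_def poly_prod)
  also have "\<dots> = poly P 1" by (simp add: \<open>P = Q\<close>)
  also have "\<dots> = of_nat t" by (simp add: P_def poly_sum poly_monom)
  finally show ?thesis .
qed

text \<open>
  Pairing \<open>k\<close> with \<open>t - k\<close>: since \<open>(1 - w\<^sup>k) (1 - w\<^sup>t\<^sup>-\<^sup>k) = - w\<^sup>t\<^sup>-\<^sup>k (1 - w\<^sup>k)\<^sup>2\<close> and \<open>w\<close> is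
  itself a square of a power of \<open>w\<close>, the product \<open>t\<close> is a square as soon as \<open>-1\<close> is.
\<close>

lemma odd_square_root_of_unity:
  assumes w: "primitive_root_of_unity t w" and t: "odd t" and i: "i ^ 2 = (-1 :: complex)"
  shows "(of_nat t :: complex) =
    (\<Prod>k=1..t div 2. i * w ^ ((t - k) * (t div 2 + 1)) * (1 - w ^ k)) ^ 2"
proof -
  interpret primitive_root t w by unfold_locales (rule w)
  define r where "r = t div 2"
  have tr: "t = 2 * r + 1" using t by (auto simp: r_def elim!: oddE)
  have "(of_nat t :: complex) = (\<Prod>k=1..<t. 1 - w ^ k)"
    using prod_one_minus_root_of_unity_powers[OF w] by simp
  also have "{1..<t} = {1..r} \<union> {r+1..<t}" using tr by auto
  also have "(\<Prod>k\<in>\<dots>. 1 - w ^ k) = (\<Prod>k=1..r. 1 - w ^ k) * (\<Prod>k=r+1..<t. 1 - w ^ k)"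
    by (rule prod.union_disjoint) auto
  also have "(\<Prod>k=r+1..<t. 1 - w ^ k) = (\<Prod>k=1..r. 1 - w ^ (t - k))"
    by (rule prod.reindex_bij_witness[of _ "\<lambda>k. t - k" "\<lambda>k. t - k"]) (use tr in auto)
  also have "(\<Prod>k=1..r. 1 - w ^ k) * \<dots> = (\<Prod>k=1..r. (1 - w ^ k) * (1 - w ^ (t - k)))"
    by (simp add: prod.distrib)
  also have "\<dots> = (\<Prod>k=1..r. (i * w ^ ((t - k) * (r + 1)) * (1 - w ^ k)) ^ 2)"
  proof (rule prod.cong)
    fix k assume "k \<in> {1..r}"
    hence k: "k \<le> t" using tr by auto
    have 1: "w ^ k * w ^ (t - k) = 1" using k by (simp add: pow_d flip: power_add)
    \<comment> \<open>Since 2 (r + 1) = t + 1, doubling the exponent gives \<open>t - k\<close>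
      modulo \<open>t\<close>.\<close>
    have "(w ^ ((t - k) * (r + 1))) ^ 2 = w ^ ((t - k) * (t + 1))"
      unfolding power_mult[symmetric] by (simp add: tr algebra_simps)
    also have "(t - k) * (t + 1) = t * (t - k) + (t - k)" by simp
    also have "w ^ \<dots> = (w ^ t) ^ (t - k) * w ^ (t - k)" by (simp only: power_add power_mult)
    finally have 2: "(w ^ ((t - k) * (r + 1))) ^ 2 = w ^ (t - k)" by (simp add: pow_d)
    have "(1 - x) * (1 - y) = - y * (1 - x) ^ 2" if "x * y = 1" for x y :: complex
    proof -
      have "- y * (1 - x) ^ 2 = - y + 2 * (x * y) - x * (x * y)"
        by (simp add: power2_eq_square algebra_simps)
      thus ?thesis unfolding that using that by (simp add: algebra_simps)
    qed
    note this[OF 1]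
    also have "- (w ^ (t - k)) * (1 - w ^ k) ^ 2 = (i * w ^ ((t - k) * (r + 1)) * (1 - w ^ k)) ^ 2"
      unfolding power_mult_distrib i 2 by simp
    finally show "(1 - w ^ k) * (1 - w ^ (t - k)) = (i * w ^ ((t - k) * (r + 1)) * (1 - w ^ k)) ^ 2" .
  qed simp
  finally show ?thesis by (simp add: prod_power_distrib r_def)
qed

lemma primitive_root_of_unity_power:
  assumes "primitive_root_of_unity (t * e) z"
  shows "primitive_root_of_unity t (z ^ e)"
proof -
  interpret primitive_root "t * e" z by unfold_locales (rule assms)
  have te: "t > 0" "e > 0" using d_pos by auto
  have "(z ^ e) ^ k \<noteq> 1" if "0 < k" "k < t" for k
  proof -
    have "z ^ (e * k) \<noteq> 1" using that te by (intro pow_neq_1) (auto simp: mult.commute)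
    thus ?thesis by (simp add: power_mult)
  qed
  moreover have "(z ^ e) ^ t = 1" using pow_d by (metis mult.commute power_mult)
  ultimately show ?thesis using te by (simp add: primitive_root_of_unity_def)
qed

section \<open>The criterion by squarefree parts\<close>

context primitive_root
begin

text \<open>As \<open>sqf m\<close> is squarefree, \<open>p\<close> divides it exactly once.
  Clearing the denominator of \<open>x\<close> then yields the equation excluded by descent.\<close>

lemma prime_dvd_if_square_root_in:
  assumes m: "m \<noteq> 0" and x: "x ^ 2 = of_int m" "x \<in> adjoin_Q {z}"
    and p: "prime p" "int p dvd sqf m"
  shows "p dvd d"
proof (rule ccontr)
  assume "\<not> p dvd d"
  obtain c where c: "m = sqf m * c ^ 2" "c \<noteq> 0" "squarefree (sqf m)" "sqf m \<noteq> 0"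
    using m by (rule sqf_decomposition)
  obtain s where s: "sqf m = int p * s" using p(2) by (rule dvdE)
  have "\<not> int p dvd s"
  proof
    assume "int p dvd s"
    hence "int p ^ 2 dvd sqf m" unfolding s by (simp add: power2_eq_square)
    hence "int p dvd 1" using c(3) squarefreeD by blast
    thus False using prime_gt_1_nat[OF p(1)] by simp
  qed
  obtain M g where M: "M \<noteq> 0" "of_int M * x = ev z g"
    using x(2) unfolding adjoin_root_of_unity_eq[OF pow_d d_pos] by (rule rat_poly_valuesE)
  have "ev z g ^ 2 = of_int (M ^ 2 * m)" using x(1) by (simp add: power_mult_distrib flip: M(2))
  also have "M ^ 2 * m = int p * s * (M * c) ^ 2"
    by (subst c(1)) (simp add: s power_mult_distrib mult_ac)
  finally have "ev z g ^ 2 = of_int (int p * s * (M * c) ^ 2)" .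
  moreover have "M * c \<noteq> 0" using M c by simp
  ultimately show False
    using ev_square_neq_mult_square[OF pow_d d_pos p(1) \<open>\<not> p dvd d\<close> \<open>\<not> int p dvd s\<close>] by blast
qed

lemma sqf_dvd_if_square_root_in:
  assumes m: "m \<noteq> 0" and x: "x ^ 2 = of_int m" "x \<in> adjoin_Q {z}"
  shows "sqf m dvd int d"
proof (rule multiplicity_le_imp_dvd)
  obtain c where c: "squarefree (sqf m)" "sqf m \<noteq> 0"
    using m by (rule sqf_decomposition)
  show "sqf m \<noteq> 0" by fact
  fix p :: int assume p: "prime p"
  show "multiplicity p (sqf m) \<le> multiplicity p (int d)"
  proof (cases "p dvd sqf m")
    case True
    have "p = int (nat p)" "prime (nat p)" using p prime_gt_0_int[OF p] by auto
    hence "nat p dvd d" using prime_dvd_if_square_root_in[OF m x, of "nat p"] True by simp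
    hence "p dvd int d" using \<open>p = int (nat p)\<close> by (metis int_dvd_int_iff)
    hence "multiplicity p (int d) \<ge> 1"
      using d_pos p not_prime_unit by (intro multiplicity_geI) auto
    moreover have "multiplicity p (sqf m) \<le> 1"
      using c p squarefree_factorial_semiring'' by blast
    ultimately show ?thesis by linarith
  qed (simp add: not_dvd_imp_multiplicity_0)
qed

text \<open>Up to a square, \<open>m\<close> is a product of a sign, a power of 2 and an odd divisor
  of \<open>d\<close>, and each of these has a square root in the field.\<close>

lemma square_root_in_if_sqf_dvd:
  assumes d8: "8 dvd d" and m: "m \<noteq> 0" "sqf m dvd int d" and x: "x ^ 2 = of_int m"
  shows "x \<in> adjoin_Q {z}"
proof -
  let ?K = "adjoin_Q {z}"
  interpret K: complex_subfield ?K by (rule complex_subfield_adjoin_Q)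
  have zK: "z \<in> ?K" using subset_adjoin_Q[of "{z}"] by simp
  define sq where "sq n \<longleftrightarrow> (\<exists>y\<in>?K. y ^ 2 = of_int n)" for n
  have sq_mult: "sq (a * b)" if "sq a" "sq b" for a b
  proof -
    from that obtain y y' where "y \<in> ?K" "y' \<in> ?K" "y ^ 2 = of_int a" "y' ^ 2 = of_int b"
      by (auto simp: sq_def)
    thus ?thesis unfolding sq_def by (intro bexI[of _ "y * y'"]) (auto simp: power_mult_distrib)
  qed
  have sq_square: "sq (a ^ 2)" for a unfolding sq_def by (intro bexI[of _ "of_int a"]) auto
  obtain e where e: "d = 8 * e" using d8 by (rule dvdE)
  define u where "u = z ^ e"
  have uK: "u \<in> ?K" using zK by (auto simp: u_def)
  have "primitive_root_of_unity 8 u" unfolding u_def using prim e by (intro primitive_root_of_unity_power) simp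
  hence u8: "u ^ 8 = 1" "u ^ 4 \<noteq> 1" by (auto simp: primitive_root_of_unity_def)
  have "(u ^ 4 - 1) * (u ^ 4 + 1) = u ^ 8 - 1" by (simp add: algebra_simps flip: power_add)
  hence u4: "u ^ 4 = - 1" using u8 by (simp add: eq_neg_iff_add_eq_0)
  have i: "(u ^ 2) ^ 2 = - 1" using u4 by (simp flip: power_mult)
  hence sq_m1: "sq (- 1)" unfolding sq_def using uK by (intro bexI[of _ "u ^ 2"]) auto
  \<comment> \<open>As u^4 = -1, the element u - u^3 is u + 1/u, the familiar square root of
    2.\<close>
  have "(u - u ^ 3) ^ 2 = u ^ 2 - 2 * u ^ 4 + u ^ 4 * u ^ 2"
    by (simp add: eval_nat_numeral algebra_simps)
  also have "\<dots> = 2" unfolding u4 by simp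
  finally have sq_2: "sq 2" unfolding sq_def using uK by (intro bexI[of _ "u - u ^ 3"]) auto
  have sq_odd: "sq (int t)" if t: "odd t" "t dvd d" for t
  proof -
    obtain l where l: "d = t * l" using t(2) by (rule dvdE)
    define w where "w = z ^ l"
    have w: "primitive_root_of_unity t w" unfolding w_def
      using prim l by (intro primitive_root_of_unity_power) simp
    have wK: "w \<in> ?K" using zK by (auto simp: w_def)
    let ?y = "\<Prod>k=1..t div 2. u ^ 2 * w ^ ((t - k) * (t div 2 + 1)) * (1 - w ^ k)"
    have "?y \<in> ?K" using uK wK by (intro K.prod K.mult K.power K.diff) auto
    moreover have "of_nat t = ?y ^ 2" using w t(1) i by (rule odd_square_root_of_unity)
    ultimately show ?thesis unfolding sq_def by (intro bexI[of _ ?y]) auto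
  qed
  obtain c where c: "m = sqf m * c ^ 2" "c \<noteq> 0" "squarefree (sqf m)" "sqf m \<noteq> 0"
    using m(1) by (rule sqf_decomposition)
  define s where "s = nat \<bar>sqf m\<bar>"
  have s: "int s = \<bar>sqf m\<bar>" "s \<noteq> 0" using c(4) by (auto simp: s_def)
  have "int s dvd int d" using m(2) s(1) by simp
  hence "s dvd d" by simp
  obtain k t where kt: "s = 2 ^ k * t" "odd t"
  proof -
    obtain t where "s = 2 ^ multiplicity 2 s * t" "\<not> 2 dvd t"
      using s(2) by (rule multiplicity_decompose'[of s 2]) auto
    thus ?thesis using that by blast
  qed
  have "t dvd d" using kt(1) \<open>s dvd d\<close> dvd_mult_right by blast
  hence "sq (int t)" using sq_odd kt(2) by blast
  moreover have "sq (2 ^ k)" by (induction k) (use sq_square[of 1] sq_mult sq_2 in auto)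
  ultimately have "sq (int s)" using sq_mult[of "2 ^ k" "int t"] kt(1) by simp
  hence "sq (sqf m)" using s(1) sq_mult[OF sq_m1, of "int s"] by (cases "sqf m \<ge> 0") auto
  hence "sq m" using sq_mult[OF _ sq_square[of c]] c(1) by metis
  then obtain y where "y \<in> ?K" "y ^ 2 = x ^ 2" using x by (auto simp: sq_def)
  thus ?thesis by (rule K.square_root_in)
qed

end

section \<open>Adjoining square roots\<close>

abbreviation adjoin :: "complex set \<Rightarrow> complex set \<Rightarrow> complex set" where
  "adjoin F A \<equiv> generate_field complex_ring (F \<union> A)"

lemma complex_subfield_adjoin: "complex_subfield (adjoin F A)"
  by (rule complex_subfield.intro) (rule field.generate_field_is_subfield[OF field_complex_ring], simp)

lemma adjoin_upper: "F \<subseteq> adjoin F A" "A \<subseteq> adjoin F A"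
  by (auto intro: generate_field.incl)

lemma adjoin_least:
  assumes "complex_subfield K" "F \<subseteq> K" "A \<subseteq> K"
  shows "adjoin F A \<subseteq> K"
  by (rule field.generate_field_min_subfield1[OF field_complex_ring])
    (use assms complex_subfield.subfield in auto)

lemma adjoin_adjoin: "adjoin (adjoin F A) B = adjoin F (A \<union> B)"
proof
  show "adjoin (adjoin F A) B \<subseteq> adjoin F (A \<union> B)"
    by (intro adjoin_least complex_subfield_adjoin) (auto intro: generate_field.incl)
  show "adjoin F (A \<union> B) \<subseteq> adjoin (adjoin F A) B"
  proof (rule adjoin_least[OF complex_subfield_adjoin])
    show "F \<subseteq> adjoin (adjoin F A) B" "A \<union> B \<subseteq> adjoin (adjoin F A) B"
      by (blast intro: generate_field.incl)+
  qed
qed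

lemma adjoin_self:
  assumes "complex_subfield F" "A \<subseteq> F"
  shows "adjoin F A = F"
  using adjoin_least[OF assms(1) order_refl assms(2)] adjoin_upper by auto

lemma (in complex_subfield) quadratic_extension:
  assumes a: "a \<notin> K" "a ^ 2 \<in> K"
  shows "adjoin K {a} = {x + y * a |x y. x \<in> K \<and> y \<in> K}" (is "?L = ?R")
    and "C.dimension 2 K (adjoin K {a})"
proof -
  have RI: "u \<in> ?R" if "x \<in> K" "y \<in> K" "u = x + y * a" for x y u
    using that by blast
  have "complex_subfield ?R"
  proof (rule complex_subfield.intro, rule subfield_complexI)
    show "1 \<in> ?R" by (rule RI[of 1 0]) auto
  next
    fix u assume "u \<in> ?R"
    then obtain x y where "x \<in> K" "y \<in> K" "u = x + y * a" by blast
    thus "- u \<in> ?R" by (intro RI[of "- x" "- y"]) auto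
  next
    fix u v assume "u \<in> ?R" "v \<in> ?R"
    then obtain x y x' y' where *: "x \<in> K" "y \<in> K" "x' \<in> K" "y' \<in> K"
        "u = x + y * a" "v = x' + y' * a" by blast
    show "u + v \<in> ?R" using * by (intro RI[of "x + x'" "y + y'"]) (auto simp: algebra_simps)
    have "x * x' + y * y' * a ^ 2 \<in> K" "x * y' + y * x' \<in> K"
      by (intro add mult *(1-4) a(2))+
    moreover have "u * v = (x * x' + y * y' * a ^ 2) + (x * y' + y * x') * a"
      unfolding *(5,6) by (simp add: algebra_simps power2_eq_square)
    ultimately show "u * v \<in> ?R" by (rule RI)
  next
    fix u assume "u \<in> ?R" and u: "u \<noteq> 0"
    then obtain x y where xy: "x \<in> K" "y \<in> K" "u = x + y * a" by blast
    \<comment> \<open>The norm of \<open>u\<close>; it is nonzero because \<open>a\<close> is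
      outside \<open>K\<close>, and it yields the inverse through the conjugate
      \<open>x - y * a\<close>.\<close>
    define D where "D = x ^ 2 - y ^ 2 * a ^ 2"
    have D: "D = u * (x - y * a)" by (simp add: D_def xy(3) power2_eq_square algebra_simps)
    have "x - y * a \<noteq> 0"
    proof
      assume 0: "x - y * a = 0"
      hence "y \<noteq> 0" using u xy(3) by auto
      hence "a = x / y" using 0 by (simp add: field_simps)
      thus False using a(1) xy by auto
    qed
    hence "D \<noteq> 0" unfolding D using u by simp
    have "D \<in> K" unfolding D_def using xy a(2) by auto
    have "inverse u = (x - y * a) / D" unfolding D using u \<open>x - y * a \<noteq> 0\<close> by (simp add: inverse_eq_divide)
    also have "\<dots> = x / D + (- y / D) * a" using \<open>D \<noteq> 0\<close> by (simp add: field_simps)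
    finally show "inverse u \<in> ?R" using xy \<open>D \<in> K\<close> by (intro RI[of "x / D" "- y / D"]) auto
  qed
  moreover have "x \<in> ?R" if "x \<in> K" for x using that by (intro RI[of x 0]) auto
  moreover have "a \<in> ?R" by (rule RI[of 0 1]) auto
  ultimately have "?L \<subseteq> ?R" by (intro adjoin_least) auto
  moreover have "?R \<subseteq> ?L"
  proof -
    interpret L: complex_subfield ?L by (rule complex_subfield_adjoin)
    have "x \<in> ?L" if "x \<in> K" for x using that by (auto intro: generate_field.incl)
    moreover have "a \<in> ?L" by (auto intro: generate_field.incl)
    ultimately show ?thesis using L.add L.mult by blast
  qed
  ultimately show eq: "?L = ?R" by blast
  have "C.dimension (Suc 1) K (C.line_extension K a K)"
    using a(1) C.dimension_one[OF subfield] by (intro C.Suc_dim) auto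
  also have "C.line_extension K a K = ?R"
    by (auto simp: C.line_extension_mem_iff) (metis add.commute)+
  finally show "C.dimension 2 K ?L" unfolding eq by (simp add: numeral_2_eq_2)
qed

text \<open>The admissible subsets pair off as \<open>T\<close> and \<open>insert a T\<close>. This
  counts the case of a root already in the base field.\<close>

lemma Pow_insert_filter_card:
  assumes "finite S" "a \<notin> S" "\<And>T. T \<subseteq> S \<Longrightarrow> P (insert a T) \<longleftrightarrow> P T"
  shows "card {T. T \<subseteq> insert a S \<and> P T} = 2 * card {T. T \<subseteq> S \<and> P T}"
proof -
  let ?A = "{T. T \<subseteq> S \<and> P T}"
  have "{T. T \<subseteq> insert a S \<and> P T} = ?A \<union> insert a ` ?A"
  proof (intro equalityI subsetI)
    fix T assume T: "T \<in> {T. T \<subseteq> insert a S \<and> P T}"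
    show "T \<in> ?A \<union> insert a ` ?A"
    proof (cases "a \<in> T")
      case True
      hence "T = insert a (T - {a})" by auto
      moreover have "T - {a} \<subseteq> S" using T by auto
      ultimately have "T - {a} \<in> ?A" using T assms(3)[of "T - {a}"] by auto
      thus ?thesis using \<open>T = insert a (T - {a})\<close> by blast
    qed (use T in auto)
  next
    fix T assume "T \<in> ?A \<union> insert a ` ?A"
    thus "T \<in> {T. T \<subseteq> insert a S \<and> P T}" using assms(3) by auto
  qed
  moreover have "card (?A \<union> insert a ` ?A) = card ?A + card (insert a ` ?A)"
    using assms(1,2) by (intro card_Un_disjoint) auto
  moreover have "card (insert a ` ?A) = card ?A"
    using assms(2) by (intro card_image inj_onI) (metis (no_types, lifting) insert_ident mem_Collect_eq subsetD)
  ultimately show ?thesis by simp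
qed

text \<open>
  If \<open>a = r \<alpha>\<close> generates a proper quadratic extension of \<open>F\<close>, then \<open>x + y a\<close> with \<open>x, y \<in> F\<close> has
  its square in \<open>F\<close> only if \<open>x = 0\<close> or \<open>y = 0\<close>. So a product of roots lies in \<open>F(a)\<close>
  iff it lies in \<open>F\<close> or its product with \<open>a\<close> does, and never both.
\<close>

lemma dimension_adjoin_square_roots:
  assumes "finite S" "complex_subfield F"
    and "\<And>s. s \<in> S \<Longrightarrow> r s \<noteq> 0" "\<And>s. s \<in> S \<Longrightarrow> r s ^ 2 \<in> F"
  shows "\<exists>n. C.dimension n F (adjoin F (r ` S)) \<and>
    n * card {T. T \<subseteq> S \<and> (\<Prod>s\<in>T. r s) \<in> F} = 2 ^ card S"
  using assms
proof (induction S arbitrary: F rule: finite_induct)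
  case (empty F)
  interpret complex_subfield F by (rule empty.prems)
  have "{T. T \<subseteq> {} \<and> (\<Prod>s\<in>T. r s) \<in> F} = {{}}" by auto
  moreover have "adjoin F {} = F" using complex_subfield_axioms by (rule adjoin_self) simp
  ultimately show ?case using C.dimension_one[OF subfield] by (intro exI[of _ 1]) simp
next
  case (insert a S F)
  interpret complex_subfield F by (rule insert.prems)
  \<comment> \<open>The induction hypothesis is applied over the larger base
    \<open>G\<close>.\<close>
  define G where "G = adjoin F {r a}"
  have G: "complex_subfield G" unfolding G_def by (rule complex_subfield_adjoin)
  interpret G: complex_subfield G by (rule G)
  have FG: "F \<subseteq> G" unfolding G_def by (rule adjoin_upper)
  have eq: "adjoin F (r ` insert a S) = adjoin G (r ` S)"
    unfolding G_def adjoin_adjoin by simp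
  have prod_insert: "(\<Prod>s\<in>insert a T. r s) = r a * (\<Prod>s\<in>T. r s)" if "T \<subseteq> S" for T
    using that insert.hyps finite_subset[of T S] by (intro prod.insert) auto
  have ra: "r a \<noteq> 0" "r a ^ 2 \<in> F" using insert.prems by auto
  have "\<exists>n. C.dimension n G (adjoin G (r ` S)) \<and>
    n * card {T. T \<subseteq> S \<and> (\<Prod>s\<in>T. r s) \<in> G} = 2 ^ card S"
    using insert.prems FG by (intro insert.IH G) auto
  then obtain n where n: "C.dimension n G (adjoin G (r ` S))"
    "n * card {T. T \<subseteq> S \<and> (\<Prod>s\<in>T. r s) \<in> G} = 2 ^ card S" by blast
  show ?case
  proof (cases "r a \<in> F")
    case True
    hence "G = F" unfolding G_def using complex_subfield_axioms by (intro adjoin_self) auto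
    have "(\<Prod>s\<in>insert a T. r s) \<in> F \<longleftrightarrow> (\<Prod>s\<in>T. r s) \<in> F" if "T \<subseteq> S" for T
    proof
      assume "(\<Prod>s\<in>insert a T. r s) \<in> F"
      hence "r a * (\<Prod>s\<in>T. r s) / r a \<in> F" using True unfolding prod_insert[OF that] by (intro divide)
      thus "(\<Prod>s\<in>T. r s) \<in> F" using ra by simp
    next
      assume "(\<Prod>s\<in>T. r s) \<in> F"
      thus "(\<Prod>s\<in>insert a T. r s) \<in> F" unfolding prod_insert[OF that] using True by (rule mult[rotated])
    qed
    hence "card {T. T \<subseteq> insert a S \<and> (\<Prod>s\<in>T. r s) \<in> F} = 2 * card {T. T \<subseteq> S \<and> (\<Prod>s\<in>T. r s) \<in> F}"
      using insert.hyps by (intro Pow_insert_filter_card)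
    moreover have "card (insert a S) = Suc (card S)" using insert.hyps by simp
    ultimately show ?thesis using n unfolding eq \<open>G = F\<close> by (intro exI[of _ n]) simp
  next
    case False
    note quad = quadratic_extension[OF False ra(2), folded G_def]
    let ?A = "{T. T \<subseteq> insert a S \<and> (\<Prod>s\<in>T. r s) \<in> F}"
    let ?B = "{T. T \<subseteq> S \<and> (\<Prod>s\<in>T. r s) \<in> G}"
    have not_both: False if "T \<subseteq> S" "(\<Prod>s\<in>T. r s) \<in> F" "(\<Prod>s\<in>insert a T. r s) \<in> F" for T
    proof -
      have "(\<Prod>s\<in>T. r s) \<noteq> 0"
        using that(1) insert.prems(2) insert.hyps finite_subset[of T S] by (subst prod_zero_iff) auto
      hence "r a = (\<Prod>s\<in>insert a T. r s) / (\<Prod>s\<in>T. r s)" unfolding prod_insert[OF that(1)] by simp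
      thus False using divide[OF that(3,2)] False by simp
    qed
    \<comment> \<open>Removing \<open>a\<close> is a bijection from \<open>?A\<close> onto
      \<open>?B\<close>. The count thus stays the same while the degree doubles.\<close>
    have "inj_on (\<lambda>T. T - {a}) ?A"
    proof (rule inj_onI)
      fix T U assume T: "T \<in> ?A" and U: "U \<in> ?A" and TU: "T - {a} = U - {a}"
      show "T = U"
      proof (rule ccontr)
        assume "T \<noteq> U"
        define V where "V = T - {a}"
        have "V \<subseteq> S" using T by (auto simp: V_def)
        moreover have "(T = V \<and> U = insert a V) \<or> (U = V \<and> T = insert a V)"
          using TU \<open>T \<noteq> U\<close> unfolding V_def by auto
        ultimately show False using not_both[of V] T U by auto
      qed
    qed
    moreover have "(\<lambda>T. T - {a}) ` ?A = ?B"
    proof (intro equalityI subsetI)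
      fix V assume "V \<in> (\<lambda>T. T - {a}) ` ?A"
      then obtain T where T: "V = T - {a}" "T \<subseteq> insert a S" "(\<Prod>s\<in>T. r s) \<in> F" by auto
      have VS: "V \<subseteq> S" using T by auto
      have "(\<Prod>s\<in>V. r s) \<in> G"
      proof (cases "a \<in> T")
        case True
        hence "T = insert a V" using T(1) by auto
        hence "r a * (\<Prod>s\<in>V. r s) \<in> F" using T(3) prod_insert[OF VS] by simp
        moreover have "r a \<in> G" unfolding G_def using adjoin_upper(2)[of "{r a}" F] by simp
        ultimately have "r a * (\<Prod>s\<in>V. r s) / r a \<in> G" using FG by (intro G.divide) auto
        thus ?thesis using ra by simp
      qed (use T FG in auto)
      thus "V \<in> ?B" using VS by simp
    next
      fix T assume "T \<in> ?B"
      hence T: "T \<subseteq> S" "(\<Prod>s\<in>T. r s) \<in> G" by auto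
      then obtain x y where xy: "x \<in> F" "y \<in> F" "(\<Prod>s\<in>T. r s) = x + y * r a"
        unfolding quad(1) by blast
      have aT: "a \<notin> T" using T insert.hyps by auto
      have "(\<Prod>s\<in>T. r s ^ 2) \<in> F" using T(1) insert.prems by (intro prod) auto
      hence sq: "(x + y * r a) ^ 2 \<in> F" unfolding xy(3)[symmetric] by (simp add: prod_power_distrib)
      have "x = 0 \<or> y = 0"
      proof (rule ccontr)
        assume nz: "\<not> (x = 0 \<or> y = 0)"
        have 2: "2 * x * y \<in> F" using xy of_nat[of 2] by (intro mult) auto
        have "x ^ 2 \<in> F" "y ^ 2 * r a ^ 2 \<in> F"
          using xy(1) power[of y 2] mult[OF _ ra(2)] xy(2) by (auto intro: power)
        \<comment> \<open>The cross term \<open>2 * x * y * r a\<close> lies in \<open>F\<close>;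
          dividing it by \<open>2 * x * y\<close> would put \<open>r a\<close> in
          \<open>F\<close>.\<close>
        hence "(x + y * r a) ^ 2 - x ^ 2 - y ^ 2 * r a ^ 2 \<in> F" using diff sq by blast
        hence "((x + y * r a) ^ 2 - x ^ 2 - y ^ 2 * r a ^ 2) / (2 * x * y) \<in> F"
          using 2 by (rule divide)
        also have "(x + y * r a) ^ 2 - x ^ 2 - y ^ 2 * r a ^ 2 = (2 * x * y) * r a"
          by (simp add: power2_eq_square algebra_simps)
        also have "\<dots> / (2 * x * y) = r a" using nz by simp
        finally show False using False by simp
      qed
      thus "T \<in> (\<lambda>T. T - {a}) ` ?A"
      proof
        assume "y = 0"
        hence "(\<Prod>s\<in>T. r s) \<in> F" using xy(1,3) by simp
        hence "T \<in> ?A" using T(1) by blast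
        moreover have "T = T - {a}" using aT by simp
        ultimately show ?thesis by (rule rev_image_eqI)
      next
        assume "x = 0"
        hence "(\<Prod>s\<in>insert a T. r s) = y * r a ^ 2"
          unfolding prod_insert[OF T(1)] xy(3) by (simp add: power2_eq_square)
        hence "(\<Prod>s\<in>insert a T. r s) \<in> F" using mult[OF xy(2) ra(2)] by argo
        hence "insert a T \<in> ?A" using T(1) by blast
        moreover have "T = insert a T - {a}" using aT by simp
        ultimately show ?thesis by (rule rev_image_eqI)
      qed
    qed
    ultimately have card_eq: "card ?B = card ?A" using card_image by fastforce
    have "C.dimension (2 * n) F (adjoin G (r ` S))"
      using subfield G.subfield quad(2) n(1) by (rule C.telescopic_base)
    moreover have "2 * n * card ?A = 2 ^ card (insert a S)"
      using n(2) insert.hyps unfolding card_eq by simp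
    ultimately show ?thesis unfolding eq by blast
  qed
qed

section \<open>Counting subsets by cosets\<close>

text \<open>The squarefree part is constant on cosets, so the subsets counted on the right form a
  disjoint union of cosets, each as large as \<open>square_subsets S\<close>.\<close>

lemma card_D0_bar:
  assumes S: "finite S" "0 \<notin> S"
  shows "card (D0_bar S d) * card (square_subsets S) = card {T. T \<subseteq> S \<and> \<bar>sqf_set T\<bar> dvd int d}"
proof -
  let ?G = "subset_group S" and ?H = "square_subsets S"
  let ?A = "{T. T \<subseteq> S \<and> \<bar>sqf_set T\<bar> dvd int d}"
  interpret G: comm_group ?G by (rule comm_group_subset_group)
  have H: "subgroup ?H ?G" by (rule subgroup_square_subsets[OF S])
  have carrier: "carrier ?G = Pow S" by (simp add: subset_group_def)
  have quot: "carrier (subset_quotient S) = rcosets\<^bsub>?G\<^esub> ?H"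
    by (simp add: subset_quotient_def FactGroup_def)
  have Hsub: "?H \<subseteq> carrier ?G" using H by (rule subgroup.subset)
  have Un: "\<Union>(D0_bar S d) = ?A"
  proof (intro equalityI subsetI)
    fix T assume "T \<in> \<Union>(D0_bar S d)"
    then obtain U where U: "U \<subseteq> S" "T \<in> ?H #>\<^bsub>?G\<^esub> U" "\<bar>sqf_coset (?H #>\<^bsub>?G\<^esub> U)\<bar> dvd int d"
      unfolding D0_bar_def quot RCOSETS_def carrier by auto
    have eq: "?H #>\<^bsub>?G\<^esub> U = ?H #>\<^bsub>?G\<^esub> T"
      using U carrier by (intro G.repr_independence H) auto
    have "T \<in> carrier ?G" using G.r_coset_subset_G[OF Hsub, of U] U carrier by auto
    hence TS: "T \<subseteq> S" unfolding carrier by simp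
    thus "T \<in> ?A" using U(3) unfolding eq sqf_coset_r_coset[OF S TS] by simp
  next
    fix T assume T: "T \<in> ?A"
    hence TS: "T \<subseteq> S" by simp
    have "T \<in> ?H #>\<^bsub>?G\<^esub> T" using TS carrier H by (intro G.rcos_self) auto
    moreover have "?H #>\<^bsub>?G\<^esub> T \<in> D0_bar S d"
      unfolding D0_bar_def quot using T sqf_coset_r_coset[OF S TS] TS carrier
      by (auto intro!: G.rcosetsI Hsub)
    ultimately show "T \<in> \<Union>(D0_bar S d)" by blast
  qed
  have sub: "D0_bar S d \<subseteq> rcosets\<^bsub>?G\<^esub> ?H" unfolding D0_bar_def quot by auto
  have finA: "finite ?A" using S(1) by simp
  have "card ?H * card (D0_bar S d) = card (\<Union>(D0_bar S d))"
  proof (rule card_partition)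
    show "finite (D0_bar S d)" "finite (\<Union>(D0_bar S d))"
      using finite_UnionD[of "D0_bar S d"] finA unfolding Un by simp_all
    show "card c = card ?H" if "c \<in> D0_bar S d" for c
      using that sub G.card_rcosets_equal[OF _ Hsub] by auto
    show "c1 \<inter> c2 = {}" if "c1 \<in> D0_bar S d" "c2 \<in> D0_bar S d" "c1 \<noteq> c2" for c1 c2
      using that sub G.rcos_disjoint[OF H] unfolding pairwise_def disjnt_def by blast
  qed
  thus ?thesis unfolding Un by (simp add: mult.commute)
qed

theorem mainTheorem8:
  fixes S :: "int set" and n d :: nat and \<zeta> :: complex and K :: "complex set"
  assumes "finite S" and "card S = n" and "0 \<notin> S"
    and "d \<ge> 3" and "8 dvd d"
    and "primitive_root_of_unity d \<zeta>"
    and "K = adjoin_Q ((\<lambda>a. csqrt (of_int a)) ` S \<union> {\<zeta>})"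
  shows "finite_over_Q K \<and>
    real (degree_over_Q K) =
      2 ^ n * real (totient d) / (real (card (D0_bar S d)) * real (card (square_subsets S)))"
proof -
  interpret primitive_root d \<zeta> by unfold_locales (rule assms(6))
  let ?r = "\<lambda>a :: int. csqrt (of_int a)"
  let ?F = "adjoin_Q {\<zeta>}"
  let ?D = "{T. T \<subseteq> S \<and> (\<Prod>a\<in>T. ?r a) \<in> ?F}"
  interpret F: complex_subfield ?F by (rule complex_subfield_adjoin_Q)
  have K: "K = adjoin ?F (?r ` S)"
    unfolding assms(7) adjoin_Q_def adjoin_adjoin by (simp add: Un_commute)
  have "?r a \<noteq> 0" if "a \<in> S" for a using that assms(3) by auto
  moreover have "?r a ^ 2 \<in> ?F" for a by simp
  ultimately have "\<exists>k. C.dimension k ?F (adjoin ?F (?r ` S)) \<and> k * card ?D = 2 ^ card S"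
    using assms(1) F.complex_subfield_axioms by (intro dimension_adjoin_square_roots)
  then obtain k where k: "C.dimension k ?F K" "k * card ?D = 2 ^ n"
    unfolding K assms(2) by blast
  interpret Q: complex_subfield \<rat> by (rule complex_subfield_Rats)
  \<comment> \<open>Degrees multiply in the tower from the rationals through \<open>?F\<close> to
    \<open>K\<close>.\<close>
  have dim: "C.dimension (totient d * k) \<rat> K"
    using Q.subfield F.subfield dimension_adjoin_Q k(1) by (rule C.telescopic_base)
  have "(\<Prod>a\<in>T. ?r a) \<in> ?F \<longleftrightarrow> \<bar>sqf_set T\<bar> dvd int d" if "T \<subseteq> S" for T
  proof -
    have m: "\<Prod>T \<noteq> 0" using that by (rule prod_set_nonzero[OF assms(1,3)])
    \<comment> \<open>The product of the principal roots is one square root of the product of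
      \<open>T\<close>, so the criterion applies to it.\<close>
    have x: "(\<Prod>a\<in>T. ?r a) ^ 2 = of_int (\<Prod>T)" by (simp add: prod_power_distrib)
    show ?thesis unfolding sqf_set_def
      using sqf_dvd_if_square_root_in[OF m x] square_root_in_if_sqf_dvd[OF assms(5) m _ x] by auto
  qed
  hence "?D = {T. T \<subseteq> S \<and> \<bar>sqf_set T\<bar> dvd int d}" by blast
  hence "card ?D = card (D0_bar S d) * card (square_subsets S)"
    using card_D0_bar[OF assms(1,3)] by simp
  hence eq: "k * (card (D0_bar S d) * card (square_subsets S)) = 2 ^ n" using k(2) by simp
  \<comment> \<open>The denominator is a factor of \<open>2 ^ n\<close>, so the real division below
    is genuine and not the default value 0.\<close>
  hence nz: "card (D0_bar S d) * card (square_subsets S) \<noteq> 0"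
    by (metis mult_0_right power_not_zero zero_neq_numeral)
  have deg: "degree_over_Q K = totient d * k"
    using C.dimI[OF Q.subfield dim] by (simp add: over_def)
  have "real k * (real (card (D0_bar S d)) * real (card (square_subsets S))) = 2 ^ n"
    using arg_cong[OF eq, of real] by simp
  hence "real (degree_over_Q K) =
      2 ^ n * real (totient d) / (real (card (D0_bar S d)) * real (card (square_subsets S)))"
    using nz unfolding deg by (simp add: field_simps)
  thus ?thesis using C.finite_dimensionI[OF dim] by blast
qed

end
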